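(* Let $\Gamma$ be a finite simple graph on $V=\{1,\dots,n\}$, let $I$ be its edge ideal in $R=k[x_1,\dots,x_n]$, where $k$ is a field, and let $t\ge 1$ be an integer. Let $F\subseteq V$ be a vertex cover of $\Gamma$ and $P_F=(x_i \mid i\in F)$. Then $P_F$ is an associated prime of $I^t$ if and only if either $F$ is a minimal cover of $\Gamma$, or $F$ is minimal among the covers of $\Gamma$ containing $N[U]$ for some subset $U\subseteq V$ such that the induced subgraph $\Gamma_U$ is strongly non-bipartite with $\mu^*(\Gamma_U)<t$.
   Context: The edge ideal of $\Gamma$ is the ideal $I$ generated by the monomials $x_ix_j$ with $\{i,j\}$ an edge of $\Gamma$. Associated primes of $I^t$ are the associated primes of the $R$-module $R/I^t$. A (vertex) cover of $\Gamma$ is a set $F\subseteq V$ meeting every edge of $\Gamma$; minimality is with respect to inclusion. For $U\subseteq V$, $\Gamma_U$ is the induced subgraph on $U$, and the closed neighborhood $N[U]$ is the union of $U$ and the set of vertices of $\Gamma$ adjacent to vertices of $U$. A graph is strongly non-bipartite if each of its connected components contains an odd cycle. A generalized ear decomposition of a connected graph is a finite sequence of walks in the graph, each without repetition of vertices other than its endpoints (so each walk is a path of length at least 1, a cycle, or a closed walk $i,j,i$ of length 2 along an edge $\{i,j\}$), such that the first walk is closed, the endpoints of each subsequent walk are the only vertices of that walk belonging to earlier walks, and the walks pass through all vertices of the graph. (The two endpoints of a subsequent walk may coincide, and the walks need not use all edges.) An odd-beginning generalized ear decomposition of a strongly non-bipartite graph is a family of generalized ear decompositions, one of each connected component, each of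 whose first walk is an odd cycle. For a strongly non-bipartite graph $G$ with $m$ vertices and $c$ connected components, $\varphi^*(G)$ is the minimal total number of walks of even length in an odd-beginning generalized ear decomposition of $G$, and $\mu^*(G):=(\varphi^*(G)+m-c)/2$. *)

theory Defs
  imports
    "Graph_Theory.Graph_Theory"
    "HOL-Library.Poly_Mapping"
    "HOL-Algebra.Module"
    "HOL-Algebra.QuotRing"
    "HOL-Algebra.Ideal_Product"
begin

section \<open>Polynomial rings over a field in a given set of variables\<close>

text \<open>Elements of type \<^typ>\<open>('v \<Rightarrow>\<^sub>0 nat) \<Rightarrow>\<^sub>0 'k\<close> are polynomials: finitely supported
  maps from exponent vectors (monomials) to coefficients, with convolution as product.\<close>

definition poly_ring :: "'v set \<Rightarrow> (('v \<Rightarrow>\<^sub>0 nat) \<Rightarrow>\<^sub>0 'k::field) ring" where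
  "poly_ring V =
    \<lparr>carrier = {p. \<forall>m \<in> Poly_Mapping.keys p. Poly_Mapping.keys m \<subseteq> V},
     mult = (*), one = 1, zero = 0, add = (+)\<rparr>"

definition var :: "'v \<Rightarrow> ('v \<Rightarrow>\<^sub>0 nat) \<Rightarrow>\<^sub>0 'k::field" where
  "var i = Poly_Mapping.single (Poly_Mapping.single i 1) 1"

lemma var_in_poly_ring: "var i \<in> carrier (poly_ring V) \<longleftrightarrow> i \<in> V"
  by (simp add: var_def poly_ring_def)

lemma cring_poly_ring: "cring (poly_ring V :: (('v \<Rightarrow>\<^sub>0 nat) \<Rightarrow>\<^sub>0 'k::field) ring)"
proof (rule cringI)
  show "abelian_group (poly_ring V :: (('v \<Rightarrow>\<^sub>0 nat) \<Rightarrow>\<^sub>0 'k::field) ring)"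
  proof (rule abelian_groupI)
    fix x y :: "('v \<Rightarrow>\<^sub>0 nat) \<Rightarrow>\<^sub>0 'k"
    assume "x \<in> carrier (poly_ring V)" "y \<in> carrier (poly_ring V)"
    then show "x \<oplus>\<^bsub>poly_ring V\<^esub> y \<in> carrier (poly_ring V)"
      using Poly_Mapping.keys_add[of x y] by (auto simp: poly_ring_def)
  next
    fix x :: "('v \<Rightarrow>\<^sub>0 nat) \<Rightarrow>\<^sub>0 'k"
    assume "x \<in> carrier (poly_ring V)"
    then have "- x \<in> carrier (poly_ring V)" "- x + x = 0"
      by (auto simp: poly_ring_def)
    then show "\<exists>y \<in> carrier (poly_ring V). y \<oplus>\<^bsub>poly_ring V\<^esub> x = \<zero>\<^bsub>poly_ring V\<^esub>"
      by (intro bexI[of _ "- x"]) (simp_all add: poly_ring_def)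
  qed (auto simp: poly_ring_def algebra_simps)
next
  show "comm_monoid (poly_ring V :: (('v \<Rightarrow>\<^sub>0 nat) \<Rightarrow>\<^sub>0 'k::field) ring)"
  proof (rule comm_monoidI)
    fix x y :: "('v \<Rightarrow>\<^sub>0 nat) \<Rightarrow>\<^sub>0 'k"
    assume xy: "x \<in> carrier (poly_ring V)" "y \<in> carrier (poly_ring V)"
    have "Poly_Mapping.keys m \<subseteq> V" if m: "m \<in> Poly_Mapping.keys (x * y)" for m
    proof -
      obtain a b where ab: "m = a + b" "a \<in> Poly_Mapping.keys x" "b \<in> Poly_Mapping.keys y"
        using m Poly_Mapping.keys_mult[of x y] by blast
      have "Poly_Mapping.keys a \<subseteq> V" "Poly_Mapping.keys b \<subseteq> V"
        using ab xy by (auto simp: poly_ring_def)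
      then show ?thesis
        unfolding ab(1) using Poly_Mapping.keys_add[of a b] by blast
    qed
    then show "x \<otimes>\<^bsub>poly_ring V\<^esub> y \<in> carrier (poly_ring V)"
      by (simp add: poly_ring_def)
  qed (auto simp: poly_ring_def algebra_simps)
qed (auto simp: poly_ring_def algebra_simps)


section \<open>Associated primes\<close>

definition annihilator :: "('a, 'c) ring_scheme \<Rightarrow> ('a, 'b, 'd) module_scheme \<Rightarrow> 'b \<Rightarrow> 'a set" where
  "annihilator R M x = {r \<in> carrier R. r \<odot>\<^bsub>M\<^esub> x = \<zero>\<^bsub>M\<^esub>}"

definition associated_primes :: "('a, 'c) ring_scheme \<Rightarrow> ('a, 'b, 'd) module_scheme \<Rightarrow> 'a set set" where
  "associated_primes R M = {P. primeideal P R \<and> (\<exists>x \<in> carrier M. P = annihilator R M x)}"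

text \<open>The quotient \<open>R/J\<close> as an \<open>R\<close>-module.\<close>

definition quotient_module :: "('a, 'c) ring_scheme \<Rightarrow> 'a set \<Rightarrow> ('a, 'a set) module" where
  "quotient_module R J =
    \<lparr>carrier = carrier (R Quot J), mult = mult (R Quot J), one = one (R Quot J),
     zero = zero (R Quot J), add = add (R Quot J),
     smult = (\<lambda>r X. (J +>\<^bsub>R\<^esub> r) \<otimes>\<^bsub>R Quot J\<^esub> X)\<rparr>"

lemma module_quotient_module:
  assumes "cring R" and "ideal J R"
  shows "module R (quotient_module R J)"
proof -
  interpret R: cring R by fact
  interpret J: ideal J R by fact
  interpret Q: cring "R Quot J"
    by (rule J.quotient_is_cring) fact
  interpret h: ring_hom_ring R "R Quot J" "(+>\<^bsub>R\<^esub>) J"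
    by (rule J.rcos_ring_hom_ring)
  show ?thesis
  proof (rule moduleI)
    show "cring R" by fact
    show "abelian_group (quotient_module R J)"
      by (rule abelian_groupI)
         (simp_all add: quotient_module_def Q.a_assoc Q.a_comm Q.add.l_inv_ex Q.a_lcomm)
  qed (auto simp: quotient_module_def Q.l_distr Q.r_distr Q.m_assoc)
qed


section \<open>Graphs\<close>

text \<open>A finite simple graph is a \<^locale>\<open>pair_graph\<close>: an edge \<open>{i, j}\<close> is represented by
  the two arcs \<open>(i, j)\<close> and \<open>(j, i)\<close>. Since the arc relation is symmetric, its strongly
  connected components \<^const>\<open>pre_digraph.sccs\<close> are the connected components of the graph.\<close>

definition edge_ideal ::
    "(('v \<Rightarrow>\<^sub>0 nat) \<Rightarrow>\<^sub>0 'k::field) ring \<Rightarrow> ('v, 'e) pre_digraph \<Rightarrow> (('v \<Rightarrow>\<^sub>0 nat) \<Rightarrow>\<^sub>0 'k) set" where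
  "edge_ideal R G = Idl\<^bsub>R\<^esub> {var i * var j | i j. (i, j) \<in> arcs_ends G}"

definition vertex_cover :: "('v, 'e) pre_digraph \<Rightarrow> 'v set \<Rightarrow> bool" where
  "vertex_cover G F \<longleftrightarrow> F \<subseteq> verts G \<and> (\<forall>(i, j) \<in> arcs_ends G. i \<in> F \<or> j \<in> F)"

definition minimal_vertex_cover :: "('v, 'e) pre_digraph \<Rightarrow> 'v set \<Rightarrow> bool" where
  "minimal_vertex_cover G F \<longleftrightarrow>
     vertex_cover G F \<and> (\<forall>F'. vertex_cover G F' \<and> F' \<subseteq> F \<longrightarrow> F' = F)"

definition minimal_vertex_cover_containing ::
    "('v, 'e) pre_digraph \<Rightarrow> 'v set \<Rightarrow> 'v set \<Rightarrow> bool" where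
  "minimal_vertex_cover_containing G W F \<longleftrightarrow>
     vertex_cover G F \<and> W \<subseteq> F \<and> (\<forall>F'. vertex_cover G F' \<and> W \<subseteq> F' \<and> F' \<subseteq> F \<longrightarrow> F' = F)"

definition closed_neighborhood :: "('v, 'e) pre_digraph \<Rightarrow> 'v set \<Rightarrow> 'v set" where
  "closed_neighborhood G U = U \<union> {v. \<exists>u \<in> U. (u, v) \<in> arcs_ends G}"


section \<open>Generalized ear decompositions\<close>

text \<open>Walks are given by their vertex sequences. The condition below says that no vertex is
  repeated, except that the two endpoints may coincide: in a simple graph, such a walk is a path
  of length at least 1, a cycle, or a closed walk \<open>i, j, i\<close>.\<close>

definition ear_walk :: "('v, 'e) pre_digraph \<Rightarrow> 'v vwalk \<Rightarrow> bool" where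
  "ear_walk G w \<longleftrightarrow> vwalk w G \<and> 1 \<le> vwalk_length w \<and> distinct (butlast w) \<and> distinct (tl w)"

definition closed_vwalk :: "'v vwalk \<Rightarrow> bool" where
  "closed_vwalk w \<longleftrightarrow> hd w = last w"

definition odd_cycle :: "('v, 'e) pre_digraph \<Rightarrow> 'v vwalk \<Rightarrow> bool" where
  "odd_cycle G w \<longleftrightarrow>
     ear_walk G w \<and> closed_vwalk w \<and> 3 \<le> vwalk_length w \<and> odd (vwalk_length w)"

definition strongly_nonbipartite :: "('v, 'e) pre_digraph \<Rightarrow> bool" where
  "strongly_nonbipartite G \<longleftrightarrow> (\<forall>C \<in> pre_digraph.sccs G. \<exists>w. odd_cycle C w)"

text \<open>Generalized ear decompositions of a connected graph.\<close>

definition gen_ear_decomposition :: "('v, 'e) pre_digraph \<Rightarrow> 'v vwalk list \<Rightarrow> bool" where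
  "gen_ear_decomposition G ws \<longleftrightarrow>
     ws \<noteq> [] \<and>
     (\<forall>w \<in> set ws. ear_walk G w) \<and>
     closed_vwalk (hd ws) \<and>
     (\<forall>k. 0 < k \<and> k < length ws \<longrightarrow>
        set (ws ! k) \<inter> (\<Union>j<k. set (ws ! j)) = {hd (ws ! k), last (ws ! k)}) \<and>
     (\<Union>w \<in> set ws. set w) = verts G"

definition odd_beginning_gen_ear_decomposition ::
    "('v, 'e) pre_digraph \<Rightarrow> (('v, 'e) pre_digraph \<Rightarrow> 'v vwalk list) \<Rightarrow> bool" where
  "odd_beginning_gen_ear_decomposition G D \<longleftrightarrow>
     (\<forall>C \<in> pre_digraph.sccs G. gen_ear_decomposition C (D C) \<and> odd_cycle C (hd (D C)))"

definition num_even_walks :: "'v vwalk list \<Rightarrow> nat" where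
  "num_even_walks ws = length (filter (\<lambda>w. even (vwalk_length w)) ws)"

definition phi_star :: "('v, 'e) pre_digraph \<Rightarrow> nat" where
  "phi_star G = (LEAST q. \<exists>D. odd_beginning_gen_ear_decomposition G D \<and>
      q = (\<Sum>C \<in> pre_digraph.sccs G. num_even_walks (D C)))"

definition mu_star :: "('v, 'e) pre_digraph \<Rightarrow> rat" where
  "mu_star G =
     (of_nat (phi_star G) + of_nat (card (verts G)) - of_nat (card (pre_digraph.sccs G))) / 2"

end

theory Submission
  imports Defs "HOL-Library.Multiset"
begin

text \<open>Write \<open>\<nu>(a)\<close> for the largest number of edges, counted with multiplicity, whose product
  divides the monomial \<open>x\<^sup>a\<close>. Then \<open>x\<^sup>a \<in> I\<^sup>t\<close> iff \<open>\<nu>(a) \<ge> t\<close>, and \<open>P\<^sub>F\<close> is associated to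
  \<open>I\<^sup>t\<close> iff some monomial \<open>x\<^sup>a\<close> satisfies \<open>I\<^sup>t : x\<^sup>a = P\<^sub>F\<close>, i.e. \<open>\<nu>\<close> reaches \<open>t\<close> as soon as one vertex
  of \<open>F\<close> is added to \<open>a\<close>, but never by adding vertices outside \<open>F\<close>.

  Given such an \<open>a\<close> with \<open>t\<close> minimal, deleting a vertex of \<open>U = supp(a) \<inter> F\<close> does not decrease \<open>\<nu>\<close>.
  Hence \<open>U\<close> is not adjacent to the complement of \<open>F\<close>, \<open>F\<close> is minimal over \<open>N[U]\<close>, and a maximum matching of
  the restriction of \<open>a\<close> to a component of \<open>\<Gamma>\<^sub>U\<close> can avoid any given vertex. As in Lovasz' proof that
  factor-critical graphs have odd ear decompositions, alternating walks then
  cover the component by walks of odd length. Cutting these walks at repeated vertices produces a generalized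
  ear decomposition whose number of even walks is controlled by the total length.

  Conversely, an odd-beginning generalized ear decomposition of \<open>C\<close> with \<open>q\<close> even walks yields a factor-critical
  exponent vector of size \<open>q + |C|\<close> with support \<open>C\<close>, by repeating an end vertex of every even walk.
  The sum of these vectors over the components of \<open>\<Gamma>\<^sub>U\<close>, together with the vertices outside
  \<open>F\<close>, is the required \<open>a\<close>; larger powers are reached by adding edges inside \<open>U\<close>, or, when \<open>U\<close> is empty,
  edges joining \<open>F\<close> to its complement.\<close>

section \<open>Ear decompositions and factor-critical multisets\<close>

text \<open>The combinatorial part works with a bare adjacency relation on the whole graph; induced
  subgraphs enter only through their vertex sets.\<close>

locale sym_irrefl =
  fixes E :: "('v \<times> 'v) set"
  assumes adj_sym: "(x, y) \<in> E \<Longrightarrow> (y, x) \<in> E"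
    and adj_irrefl: "(x, x) \<notin> E"
begin

abbreviation walk :: "'v list \<Rightarrow> bool" where
  "walk \<equiv> successively (\<lambda>x y. (x, y) \<in> E)"

definition ear :: "'v list \<Rightarrow> bool" where
  "ear w \<longleftrightarrow> walk w \<and> 2 \<le> length w \<and> distinct (butlast w) \<and> distinct (tl w)"

text \<open>Here \<open>length w\<close> counts vertices: the walks of even length are the lists of odd length.\<close>

inductive ear_built :: "'v set \<Rightarrow> nat \<Rightarrow> bool" where
  cycle: "ear w \<Longrightarrow> hd w = last w \<Longrightarrow> 4 \<le> length w \<Longrightarrow> even (length w) \<Longrightarrow> ear_built (set w) 0"
| ear: "ear_built B q \<Longrightarrow> ear w \<Longrightarrow> set w \<inter> B = {hd w, last w} \<Longrightarrow>
    ear_built (B \<union> set w) (q + of_bool (odd (length w)))"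

text \<open>If the subgraph on \<open>B\<close> is connected and non-bipartite, the least such
  \<open>s\<close> is 2 mu* + 1. An upper bound in place of an equation lets the costs of successive
  pieces be added up.\<close>

definition ear_built_le :: "'v set \<Rightarrow> nat \<Rightarrow> bool" where
  "ear_built_le B s \<longleftrightarrow> (\<exists>q. ear_built B q \<and> q + card B \<le> s)"

lemma finite_ear_built: "ear_built B q \<Longrightarrow> finite B"
  by (induction rule: ear_built.induct) auto

lemma ear_built_le_mono: "ear_built_le B s \<Longrightarrow> s \<le> s' \<Longrightarrow> ear_built_le B s'"
  by (auto simp: ear_built_le_def)

text \<open>Cutting the walk at a vertex that is not new preserves the bound because \<open>n \<mapsto> n div 2\<close> is
  superadditive. When an inner part of the walk is closed, it has to be added after the rest.\<close>

lemma ear_built_le_walk: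
  assumes "ear_built_le B s" "walk (u # m @ [z])" "u \<in> B" "z \<in> B"
  shows "ear_built_le (B \<union> set m) (s + 2 * ((length m + 1) div 2))"
  using assms
proof (induction m arbitrary: B s u z rule: length_induct)
  case (1 m)
  note IH = 1(1) and B = 1(2) and w = 1(3) and u = 1(4) and z = 1(5)
  consider "set m \<inter> B \<noteq> {}" | "\<not> distinct m" | "set m \<inter> B = {}" "distinct m" by blast
  then show ?case
  proof cases
    case 1
    then obtain x p r where m: "m = p @ x # r" and x: "x \<in> B"
      by (metis disjoint_iff in_set_conv_decomp)
    have wp: "walk (u # p @ [x])" and wr: "walk (x # r @ [z])"
      using w by (auto simp: m successively_append_iff successively_Cons hd_append split: if_splits)
    have *: "ear_built_le (B \<union> set p) (s + 2 * ((length p + 1) div 2))"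
      using IH B wp u x by (auto simp: m)
    have "ear_built_le (B \<union> set p \<union> set r)
        (s + 2 * ((length p + 1) div 2) + 2 * ((length r + 1) div 2))"
      using IH[rule_format, of r, OF _ * wr] x z by (auto simp: m)
    moreover have "B \<union> set p \<union> set r = B \<union> set m" using x by (auto simp: m)
    moreover have "2 * ((length p + 1) div 2) + 2 * ((length r + 1) div 2)
        \<le> 2 * ((length m + 1) div 2)"
      unfolding m by simp presburger
    ultimately show ?thesis by (auto elim!: ear_built_le_mono)
  next
    case 2
    then obtain p y q r where m: "m = p @ [y] @ q @ [y] @ r"
      using not_distinct_decomp by blast
    have wp: "walk (u # (p @ [y] @ r) @ [z])" and wq: "walk (y # q @ [y])"
      using w by (auto simp: m successively_append_iff successively_Cons hd_append split: if_splits)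
    have *: "ear_built_le (B \<union> set (p @ [y] @ r)) (s + 2 * ((length (p @ [y] @ r) + 1) div 2))"
      using IH[rule_format, OF _ B wp u z] by (auto simp: m)
    have "ear_built_le (B \<union> set (p @ [y] @ r) \<union> set q)
        (s + 2 * ((length (p @ [y] @ r) + 1) div 2) + 2 * ((length q + 1) div 2))"
      using IH[rule_format, of q, OF _ * wq] by (auto simp: m)
    moreover have "B \<union> set (p @ [y] @ r) \<union> set q = B \<union> set m" by (auto simp: m)
    moreover have "2 * ((length (p @ [y] @ r) + 1) div 2) + 2 * ((length q + 1) div 2)
        \<le> 2 * ((length m + 1) div 2)"
      unfolding m by simp presburger
    ultimately show ?thesis by (auto elim!: ear_built_le_mono)
  next
    \<comment> \<open>All inner vertices are new and distinct, so the walk is a single ear. It has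
      \<open>length m + 1\<close> edges, hence counts as even iff \<open>length m\<close> is odd,
      and new vertices plus this indicator make exactly
      \<open>2 * ((length m + 1) div 2)\<close>.\<close>
    case 3
    let ?w = "u # m @ [z]"
    obtain q where q: "ear_built B q" "q + card B \<le> s" using B by (auto simp: ear_built_le_def)
    have "distinct (u # m)" "distinct (m @ [z])" using 3 u z by auto
    then have ear: "ear ?w" using w unfolding ear_def by (simp add: butlast_append)
    have "set ?w \<inter> B = {hd ?w, last ?w}" using 3 u z by auto
    from ear_built.ear[OF q(1) ear this]
    have "ear_built (B \<union> set m) (q + of_bool (odd (length m)))"
      using u z by (simp add: insert_absorb)
    moreover have "card (B \<union> set m) = card B + length m"
      using 3 finite_ear_built[OF q(1)] by (simp add: card_Un_disjoint Int_commute distinct_card)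
    ultimately show ?thesis unfolding ear_built_le_def using q(2)
      by (auto intro!: exI[of _ "q + of_bool (odd (length m))"] elim!: oddE evenE)
  qed
qed

text \<open>The closed walk has an odd number of edges. At a repeated vertex it splits into two
  closed walks, exactly one of them odd: induction handles the odd one, and
  \<open>ear_built_le_walk\<close> attaches the other. Without repetitions it is an odd
  cycle.\<close>

lemma ear_built_le_closed_walk:
  assumes "walk (x # m @ [x])" "even (length m)"
  shows "ear_built_le (insert x (set m)) (length m + 1)"
  using assms
proof (induction m arbitrary: x rule: length_induct)
  case (1 m)
  note IH = 1(1) and w = 1(2) and ev = 1(3)
  consider "x \<in> set m" | "\<not> distinct m" | "x \<notin> set m" "distinct m" by blast
  then show ?case
  proof cases
    case 1
    then obtain p r where m: "m = p @ x # r" by (metis in_set_conv_decomp)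
    have wp: "walk (x # p @ [x])" and wr: "walk (x # r @ [x])"
      using w by (auto simp: m successively_append_iff successively_Cons hd_append split: if_splits)
    show ?thesis
    proof (cases "even (length p)")
      case True
      then have *: "ear_built_le (insert x (set p)) (length p + 1)"
        using IH wp by (auto simp: m)
      from ear_built_le_walk[OF * wr] True ev show ?thesis
        by (auto simp: m Un_ac elim!: ear_built_le_mono)
    next
      case False
      then have *: "ear_built_le (insert x (set r)) (length r + 1)"
        using IH wr ev by (auto simp: m)
      from ear_built_le_walk[OF * wp] False ev show ?thesis
        by (auto simp: m Un_ac elim!: ear_built_le_mono)
    qed
  next
    case 2
    then obtain p y q r where m: "m = p @ [y] @ q @ [y] @ r"
      using not_distinct_decomp by blast
    \<comment> \<open>The second walk is the outer part rotated so that it begins and ends at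
      \<open>y\<close>, the vertex it shares with the inner closed walk.\<close>
    have wp: "walk (x # (p @ [y] @ r) @ [x])" "walk (y # (r @ [x] @ p) @ [y])"
      and wq: "walk (y # q @ [y])"
      using w by (auto simp: m successively_append_iff successively_Cons hd_append split: if_splits)
    show ?thesis
    proof (cases "even (length q)")
      case True
      then have *: "ear_built_le (insert y (set q)) (length q + 1)"
        using IH wq by (auto simp: m)
      have "insert y (set q) \<union> set (r @ [x] @ p) = insert x (set m)" by (auto simp: m)
      with ear_built_le_walk[OF * wp(2)] True ev show ?thesis
        by (auto simp: m elim!: ear_built_le_mono)
    next
      case False
      then have *: "ear_built_le (insert x (set (p @ [y] @ r))) (length (p @ [y] @ r) + 1)"
        using IH[rule_format, OF _ wp(1)] ev by (auto simp: m)
      have "insert x (set (p @ [y] @ r)) \<union> set q = insert x (set m)" by (auto simp: m)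
      with ear_built_le_walk[OF * wq] False ev show ?thesis
        by (auto simp: m elim!: ear_built_le_mono)
    qed
  next
    case 3
    \<comment> \<open>There are no loops, so some inner vertex exists; parity then yields two, and
      the cycle has length at least 3.\<close>
    have "m \<noteq> []" using w adj_irrefl by auto
    with ev have len: "2 \<le> length m" by (cases m; cases "tl m") auto
    have "distinct (x # m)" "distinct (m @ [x])" using 3 by auto
    then have "ear (x # m @ [x])" using w unfolding ear_def by (simp add: butlast_append)
    then have "ear_built (set (x # m @ [x])) 0" by (rule cycle) (use len ev in auto)
    moreover have "card (set (x # m @ [x])) = length m + 1"
      using 3 by (simp add: distinct_card)
    ultimately show ?thesis by (auto simp: ear_built_le_def)
  qed
qed


section \<open>Multisets of edges and the monomials that they divide\<close>

text \<open>A multiset \<open>a\<close> of vertices stands for the monomial \<open>x\<^sup>a\<close>, and \<open>matchable k a\<close> means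
  \<open>x\<^sup>a \<in> I\<^sup>k\<close>.\<close>

definition edges :: "'v set multiset \<Rightarrow> bool" where
  "edges M \<longleftrightarrow> (\<forall>e \<in># M. \<exists>x y. (x, y) \<in> E \<and> e = {x, y})"

definition deg :: "'v set multiset \<Rightarrow> 'v multiset" where
  "deg M = (\<Sum>e\<in>#M. mset_set e)"

definition matchable :: "nat \<Rightarrow> 'v multiset \<Rightarrow> bool" where
  "matchable k a \<longleftrightarrow> (\<exists>M. edges M \<and> size M = k \<and> deg M \<subseteq># a)"

lemma deg_simps [simp]: "deg {#} = {#}" "deg (add_mset e M) = mset_set e + deg M"
    "deg (M + N) = deg M + deg N"
  by (auto simp: deg_def)

lemma edges_simps [simp]: "edges {#}" "edges (M + N) \<longleftrightarrow> edges M \<and> edges N"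
  by (auto simp: edges_def)

lemma mset_set_edge: "(x, y) \<in> E \<Longrightarrow> mset_set {x, y} = {#x, y#}"
  using adj_irrefl by (cases "x = y") auto

lemma edges_add_mset [simp]:
  "edges (add_mset e M) \<longleftrightarrow> (\<exists>x y. (x, y) \<in> E \<and> e = {x, y}) \<and> edges M"
  by (auto simp: edges_def)

lemma edges_mono: "edges M \<Longrightarrow> N \<subseteq># M \<Longrightarrow> edges N"
  by (auto simp: edges_def dest: mset_subset_eqD)

lemma deg_mono: "N \<subseteq># M \<Longrightarrow> deg N \<subseteq># deg M"
  by (metis deg_simps(3) mset_subset_eq_add_left subset_mset.le_iff_add)

lemma deg_diff: "N \<subseteq># M \<Longrightarrow> deg (M - N) = deg M - deg N"
  by (metis add_diff_cancel_left' deg_simps(3) subset_mset.add_diff_inverse)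

lemma size_deg: "edges M \<Longrightarrow> size (deg M) = 2 * size M"
  by (induction M) (auto simp: mset_set_edge simp del: size_mset_set)

lemma edges_incident:
  assumes "edges M" "y \<in># deg M"
  obtains z where "(y, z) \<in> E" "{y, z} \<in># M"
proof -
  obtain e where e: "e \<in># M" "y \<in># mset_set e" using assms(2) by (auto simp: deg_def)
  obtain a b where ab: "(a, b) \<in> E" "e = {a, b}" using assms(1) e(1) by (auto simp: edges_def)
  then show ?thesis using that e adj_sym by (auto simp: insert_commute)
qed

lemma matchable_0 [simp]: "matchable 0 a"
  by (auto simp: matchable_def intro!: exI[of _ "{#}"])

lemma matchable_mono: "matchable k a \<Longrightarrow> a \<subseteq># b \<Longrightarrow> matchable k b"
  unfolding matchable_def using subset_mset.order_trans by blast

lemma matchable_add: "matchable k a \<Longrightarrow> matchable l b \<Longrightarrow> matchable (k + l) (a + b)"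
  unfolding matchable_def by (metis deg_simps(3) edges_simps(2) size_union subset_mset.add_mono)

lemma matchable_edge: "(x, y) \<in> E \<Longrightarrow> matchable 1 {#x, y#}"
  unfolding matchable_def by (intro exI[of _ "{#{x, y}#}"]) (auto simp: mset_set_edge)

lemma matchable_Suc: "matchable (Suc k) a \<Longrightarrow> matchable k a"
proof -
  assume "matchable (Suc k) a"
  then obtain M where M: "edges M" "size M = Suc k" "deg M \<subseteq># a" by (auto simp: matchable_def)
  then obtain e N where N: "M = add_mset e N" by (metis size_Suc_Diff1 size_eq_Suc_imp_eq_union)
  then have "deg N \<subseteq># a" using M(3) by (metis deg_simps(2) mset_subset_eq_add_right subset_mset.order_trans)
  then show ?thesis unfolding matchable_def using M N by auto
qed

text \<open>Removing one copy of \<open>i\<close> destroys at most one edge: one at \<open>i\<close>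
  if \<open>M\<close> covers \<open>i\<close>, and otherwise an arbitrary edge is given up.\<close>

lemma matchable_drop_vertex: "matchable (Suc k) (add_mset i a) \<Longrightarrow> matchable k a"
proof -
  assume "matchable (Suc k) (add_mset i a)"
  then obtain M where M: "edges M" "size M = Suc k" "deg M \<subseteq># add_mset i a"
    by (auto simp: matchable_def)
  show ?thesis
  proof (cases "i \<in># deg M")
    case True
    then obtain z where z: "(i, z) \<in> E" "{i, z} \<in># M" using M(1) edges_incident by metis
    define N where "N = M - {#{i, z}#}"
    have MN: "M = add_mset {i, z} N" using z by (simp add: N_def)
    then have "add_mset z (deg N) \<subseteq># a" using M(3) z by (simp add: mset_set_edge)
    then have "deg N \<subseteq># a" by (meson mset_subset_eq_add_mset_cancel subset_mset.order_trans mset_subset_eq_insertD subset_mset.less_imp_le)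
    then show ?thesis using M MN by (auto simp: matchable_def)
  next
    case False
    then have "deg M \<subseteq># a" using M(3) by (metis insert_DiffM2 inter_add_right1 subset_mset.le_iff_inf)
    then have "matchable (Suc k) a" using M by (auto simp: matchable_def)
    then show ?thesis by (rule matchable_Suc)
  qed
qed


section \<open>Factor-critical multisets\<close>

text \<open>Replacing each vertex by as many non-adjacent copies as its multiplicity turns this into
  the usual notion of a factor-critical graph. The empty multiset satisfies it vacuously.\<close>

definition factor_critical :: "'v multiset \<Rightarrow> bool" where
  "factor_critical d \<longleftrightarrow> (\<forall>u \<in># d. \<exists>M. edges M \<and> add_mset u (deg M) = d)"

lemma factor_critical_single: "factor_critical {#v#}"
  unfolding factor_critical_def by (auto intro: exI[of _ "{#}"])

lemma factor_critical_odd: "factor_critical d \<Longrightarrow> d \<noteq> {#} \<Longrightarrow> odd (size d)"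
  unfolding factor_critical_def by (metis dvd_triv_left even_Suc multiset_nonemptyE size_add_mset size_deg)

text \<open>After setting aside one copy of \<open>u\<close> there is still some \<open>x\<close> in
  \<open>d\<close>. The perfect matching of \<open>d\<close> without \<open>x\<close> covers
  \<open>u\<close>, and the partner of \<open>u\<close> in it is the neighbour sought.\<close>

lemma factor_critical_neighbour:
  assumes "factor_critical d" "u \<in># d" "2 \<le> size d"
  obtains x where "x \<in># d" "(u, x) \<in> E"
proof -
  have "d - {#u#} \<noteq> {#}" using assms by (metis One_nat_def Suc_1 not_less_eq_eq order_refl size_empty size_Suc_Diff1)
  then obtain x where x: "x \<in># d - {#u#}" by auto
  then obtain M where M: "edges M" "add_mset x (deg M) = d"
    using assms(1) by (meson factor_critical_def in_diffD)
  then have "u \<in># deg M" using x assms(2) by (metis add_mset_remove_trivial at_most_one_mset_mset_diff diff_single_eq_union insert_noteq_member union_single_eq_member mset_add diff_diff_add_mset add_mset_remove_trivial_If)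
  then obtain y where "(u, y) \<in> E" "{u, y} \<in># M" using M(1) edges_incident by metis
  then have "y \<in># deg M" by (auto simp: deg_def intro!: bexI[of _ "{u, y}"])
  then have "y \<in># d" using M(2) by auto
  then show ?thesis using that \<open>(u, y) \<in> E\<close> by blast
qed

lemma walk_perfect: "walk w \<Longrightarrow> even (length w) \<Longrightarrow> \<exists>M. edges M \<and> deg M = mset w"
proof (induction w rule: induct_list012)
  case (3 x y zs)
  then have "walk zs" "(x, y) \<in> E" by (auto simp: successively_Cons)
  with 3 obtain M where "edges M" "deg M = mset zs" by auto
  with \<open>(x, y) \<in> E\<close> show ?case
    by (intro exI[of _ "add_mset {x, y} M"]) (auto simp: mset_set_edge)
qed (auto intro: exI[of _ "{#}"])

text \<open>A deleted vertex inside \<open>m\<close> cuts \<open>m\<close> into an even and an odd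
  part. The even part is matched along itself, the odd one together with the end \<open>u\<close> or
  \<open>z\<close> next to it, and \<open>d\<close> without that end has a perfect matching.\<close>

lemma factor_critical_walk:
  assumes d: "factor_critical d" and w: "walk (u # m @ [z])" and m: "even (length m)"
    and u: "u \<in># d" and z: "z \<in># d"
  shows "factor_critical (d + mset m)"
  unfolding factor_critical_def
proof
  fix x assume "x \<in># d + mset m"
  then consider "x \<in># d" | "x \<in> set m" by auto
  then show "\<exists>M. edges M \<and> add_mset x (deg M) = d + mset m"
  proof cases
    case 1
    then obtain M where "edges M" "add_mset x (deg M) = d" using d by (auto simp: factor_critical_def)
    moreover obtain N where "edges N" "deg N = mset m"
      using w m by (metis successively_append_iff successively_Cons walk_perfect successively.simps(1))
    ultimately show ?thesis by (intro exI[of _ "M + N"]) auto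
  next
    case 2
    then obtain p r where pr: "m = p @ x # r" by (metis in_set_conv_decomp)
    have wp: "walk (u # p)" "walk p" and wr: "walk (r @ [z])" "walk r"
      using w by (auto simp: pr successively_append_iff successively_Cons hd_append split: if_splits)
    show ?thesis
    proof (cases "even (length p)")
      case True
      with m have "even (length (r @ [z]))" by (auto simp: pr)
      then obtain N2 where N2: "edges N2" "deg N2 = mset (r @ [z])" using wr walk_perfect by blast
      obtain N1 where N1: "edges N1" "deg N1 = mset p" using True wp walk_perfect by blast
      obtain M where "edges M" "add_mset z (deg M) = d" using d z by (auto simp: factor_critical_def)
      then show ?thesis using N1 N2 by (intro exI[of _ "M + N1 + N2"]) (auto simp: pr)
    next
      case False
      with m have "even (length r)" by (auto simp: pr)
      then obtain N2 where N2: "edges N2" "deg N2 = mset r" using wr walk_perfect by blast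
      obtain N1 where N1: "edges N1" "deg N1 = mset (u # p)"
        using False wp walk_perfect[of "u # p"] by auto
      obtain M where "edges M" "add_mset u (deg M) = d" using d u by (auto simp: factor_critical_def)
      then show ?thesis using N1 N2 by (intro exI[of _ "M + N1 + N2"]) (auto simp: pr)
    qed
  qed
qed

lemma ear_decomp_list:
  assumes "ear w"
  obtains u m z where "w = u # m @ [z]" "hd w = u" "last w = z" "distinct m" "u \<notin> set m" "z \<notin> set m"
proof -
  obtain u w' where "w = u # w'" using assms by (cases w) (auto simp: ear_def)
  moreover obtain m z where "w' = m @ [z]" using assms calculation by (cases w' rule: rev_cases) (auto simp: ear_def)
  ultimately show ?thesis using that[of u m z] assms by (auto simp: ear_def butlast_append)
qed

lemma ear_built_imp_factor_critical:
  "ear_built B q \<Longrightarrow>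
    \<exists>d. factor_critical d \<and> set_mset d = B \<and> size d = q + card B \<and> 2 \<le> size d"
proof (induction rule: ear_built.induct)
  case (cycle w)
  then obtain u m where w: "w = u # m @ [u]" "distinct m" "u \<notin> set m" by (metis ear_decomp_list)
  \<comment> \<open>An odd cycle is a walk attached with both ends to the single vertex
    \<open>u\<close>.\<close>
  have "factor_critical ({#u#} + mset m)"
    by (rule factor_critical_walk[of _ u _ u])
      (use cycle w in \<open>auto simp: ear_def factor_critical_single\<close>)
  then show ?case using w cycle by (intro exI[of _ "{#u#} + mset m"]) (auto simp: distinct_card)
next
  case (ear B q w)
  then obtain d where d: "factor_critical d" "set_mset d = B" "size d = q + card B" "2 \<le> size d" by auto
  obtain u m z where w: "w = u # m @ [z]" "hd w = u" "last w = z" "distinct m" "u \<notin> set m" "z \<notin> set m"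
    using ear_decomp_list[OF ear(2)] .
  have uz: "u \<in># d" "z \<in># d" and mB: "set m \<inter> B = {}" using ear(3) w d(2) by auto
  have B: "B \<union> set w = B \<union> set m" "finite B" using uz d(2) by (auto simp: w)
  then have card: "card (B \<union> set w) = card B + length m"
    using w mB by (simp add: card_Un_disjoint Int_commute distinct_card)
  show ?case
  proof (cases "even (length m)")
    case True
    have "factor_critical (d + mset m)"
      by (rule factor_critical_walk[of _ u _ z]) (use ear w uz d True in \<open>auto simp: ear_def\<close>)
    then show ?thesis using d card B True w(1) by (intro exI[of _ "d + mset m"]) auto
  next
    case False
    \<comment> \<open>An even ear has an odd number of inner vertices. Starting one step earlier, at
      a neighbour \<open>x\<close> of \<open>u\<close>, makes \<open>u\<close> an inner vertex too:
      parity is repaired at the cost of one extra copy of \<open>u\<close>.\<close>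
    obtain x where x: "x \<in># d" "(u, x) \<in> E" using factor_critical_neighbour[OF d(1) uz(1) d(4)] .
    have "factor_critical (d + mset (u # m))"
      by (rule factor_critical_walk[of _ x _ z])
        (use ear w uz d False x adj_sym[OF x(2)] in \<open>auto simp: ear_def\<close>)
    then show ?thesis using d card B False w(1) uz by (intro exI[of _ "d + mset (u # m)"]) auto
  qed
qed

text \<open>The walk u, x, u, x along an edge inside \<open>d\<close> adds one more copy of each of
  its two ends. This is how larger powers are reached later.\<close>

lemma factor_critical_enlarge:
  assumes "factor_critical d" "2 \<le> size d"
  shows "\<exists>d'. factor_critical d' \<and> set_mset d' = set_mset d \<and> size d' = size d + 2 * k"
proof (induction k)
  case (Suc k)
  then obtain d' where d': "factor_critical d'" "set_mset d' = set_mset d" "size d' = size d + 2 * k"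
    by auto
  obtain u where u: "u \<in># d'" using assms(2) d'(2) by fastforce
  obtain x where x: "x \<in># d'" "(u, x) \<in> E"
    using factor_critical_neighbour[OF d'(1) u] assms(2) d'(3) by auto
  have "factor_critical (d' + mset [x, u])"
    by (rule factor_critical_walk[of _ u _ x]) (use d' u x adj_sym[OF x(2)] in auto)
  then show ?case using d' u x by (intro exI[of _ "d' + mset [x, u]"]) auto
qed (use assms in auto)

text \<open>Connectivity in the form used by arguments that let a vertex set grow: as long as it is
  a proper part, some edge leads out of it.\<close>

definition connected_on :: "'v set \<Rightarrow> bool" where
  "connected_on C \<longleftrightarrow> (\<forall>B. B \<noteq> {} \<and> B \<subset> C \<longrightarrow> (\<exists>u \<in> B. \<exists>w \<in> C - B. (u, w) \<in> E))"

text \<open>A vertex \<open>w\<close> outside \<open>B\<close> with a neighbour \<open>u\<close> in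
  \<open>B\<close> is attached by the closed walk u, w, u. Thus an odd cycle in a connected set is
  always the beginning of a decomposition of the set.\<close>

lemma ear_built_extend:
  assumes "connected_on C" "finite C" "ear_built B q" "B \<subseteq> C"
  shows "\<exists>q. ear_built C q"
proof -
  have "ear_built_le B s \<Longrightarrow> B \<noteq> {} \<Longrightarrow> B \<subseteq> C \<Longrightarrow> \<exists>q. ear_built C q" for B s
  proof (induction "card (C - B)" arbitrary: B s rule: less_induct)
    case less
    show ?case
    proof (cases "B = C")
      case True
      then show ?thesis using less(2) by (auto simp: ear_built_le_def)
    next
      case False
      then obtain u w where uw: "u \<in> B" "w \<in> C - B" "(u, w) \<in> E"
        using assms(1) less(3,4) unfolding connected_on_def by (metis psubsetI)
      have "card (C - (B \<union> set [w])) < card (C - B)"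
        using uw(2) assms(2) by (intro psubset_card_mono) auto
      moreover have "ear_built_le (B \<union> set [w]) (s + 2 * ((length [w] + 1) div 2))"
        by (rule ear_built_le_walk[OF less(2), of u _ u]) (use uw adj_sym[OF uw(3)] in auto)
      moreover have "B \<union> set [w] \<noteq> {}" "B \<union> set [w] \<subseteq> C" using uw less(4) by auto
      ultimately show ?thesis by (rule less(1))
    qed
  qed
  moreover have "B \<noteq> {}" using assms(3) by (cases rule: ear_built.cases) (auto simp: ear_def)
  moreover have "ear_built_le B (q + card B)" using assms(3) by (auto simp: ear_built_le_def)
  ultimately show ?thesis using assms(4) by blast
qed

text \<open>The walk starts at \<open>w\<close>, which \<open>N\<close> leaves uncovered, and uses edges of \<open>P\<close> and \<open>N\<close>
  alternately. It cannot get stuck before it reaches \<open>d\<close>, because exchanging \<open>P\<close> and \<open>N\<close> along it would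
  produce a matching with \<open>k + 1\<close> edges; if it is stuck at a vertex missed by \<open>P\<close>, the additional
  edge is \<open>{u, w}\<close>, and \<open>d\<close> without \<open>u\<close> has a perfect matching.\<close>

lemma alternating_walk:
  assumes P: "edges P" "deg P + d \<subseteq># a" "2 * size P + size d = 2 * k + 1"
    and N: "edges N" "size N = k" "add_mset w (deg N) \<subseteq># a"
    and d: "factor_critical d"
    and uw: "u \<in># d" "w \<notin># d" "(u, w) \<in> E"
    and max: "\<not> matchable (Suc k) a"
  shows "\<exists>ys Q. walk ys \<and> ys \<noteq> [] \<and> hd ys = w \<and> last ys \<in># d \<and> Q \<subseteq># P \<and> deg Q = mset (butlast ys)"
proof (rule ccontr)
  assume none: "\<not> ?thesis"
  \<comment> \<open>If the walk never reaches \<open>d\<close>, it can be prolonged forever.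
    \<open>Q\<close> and \<open>R\<close> collect the edges of \<open>P\<close> and \<open>N\<close>
    used so far, with multiplicity, and the contradiction comes when \<open>Q\<close> outgrows
    \<open>P\<close>.\<close>
  have "\<exists>ys Q R. walk ys \<and> ys \<noteq> [] \<and> hd ys = w \<and> Q \<subseteq># P \<and> R \<subseteq># N \<and>
      deg Q = mset (butlast ys) \<and> deg R = mset (tl ys) \<and> size Q = n" for n
  proof (induction n)
    case 0
    show ?case by (intro exI[of _ "[w]"] exI[of _ "{#}"]) auto
  next
    case (Suc n)
    then obtain ys Q R where ys: "walk ys" "ys \<noteq> []" "hd ys = w" and QR: "Q \<subseteq># P" "R \<subseteq># N"
      "deg Q = mset (butlast ys)" "deg R = mset (tl ys)" "size Q = n" by blast
    define y where "y = last ys"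
    have y: "y \<notin># d" using none ys QR unfolding y_def by blast
    \<comment> \<open>Both sides equal \<open>mset ys\<close>: \<open>Q\<close> covers all entries
      but the last, and \<open>R\<close> all but the first.\<close>
    have yw: "add_mset y (deg Q) = add_mset w (deg R)"
      using ys QR by (metis append_butlast_last_id list.collapse mset.simps(2) mset_append add.commute
          add_mset_add_single mset_single_iff_right y_def mset.simps(1) union_mset_add_mset_right add.right_neutral)
    have eQ: "edges Q" "edges R" "edges (P - Q)" "edges (N - R)"
      using edges_mono P(1) N(1) QR by (meson diff_subset_eq_self)+
    have szQR: "size R = size Q"
    proof -
      have "size (deg Q) = size (deg R)" using arg_cong[OF yw, of size] by simp
      then show ?thesis using size_deg eQ by simp
    qed
    have dQ: "deg Q \<subseteq># deg P" "deg R \<subseteq># deg N" using deg_mono[OF QR(1)] deg_mono[OF QR(2)] .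
    show ?case
    proof (cases "y \<in># deg (P - Q)")
      case False
      obtain M where M: "edges M" "add_mset u (deg M) = d" using d uw(1) by (auto simp: factor_critical_def)
      let ?M = "add_mset {u, w} (M + R + (P - Q))"
      have "deg ?M = {#u, w#} + (deg M + deg R + (deg P - deg Q))"
        by (simp only: deg_simps mset_set_edge[OF uw(3)] deg_diff[OF QR(1)])
      also have "\<dots> = deg P - deg Q + (add_mset w (deg R)) + d"
        by (simp flip: M(2))
      also have "\<dots> = add_mset y (deg P + d)"
        using dQ by (simp add: subset_mset.diff_add[OF dQ(1)] flip: yw)
      finally have dM: "deg ?M = add_mset y (deg P + d)" .
      \<comment> \<open>Only at \<open>y\<close> is \<open>deg P + d\<close> exceeded. There
        \<open>d\<close> and \<open>P - Q\<close> contribute nothing, so the count is that of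
        \<open>add_mset w (deg R)\<close>, which the hypothesis on \<open>N\<close> bounds.\<close>
      have "count (add_mset y (deg P + d)) v \<le> count a v" for v
      proof (cases "v = y")
        case True
        have "count (deg P) y = count (deg Q) y"
          using False dQ QR by (simp add: deg_diff not_in_iff mset_subset_eq_count antisym)
        then have "count (add_mset y (deg P + d)) y = count (add_mset w (deg R)) y"
          using y by (simp add: not_in_iff flip: yw)
        also have "\<dots> \<le> count (add_mset w (deg N)) y"
          using dQ(2) by (simp add: mset_subset_eq_count)
        also have "\<dots> \<le> count a y" using N(3) by (rule mset_subset_eq_count)
        finally show ?thesis using True by simp
      next
        case False
        then show ?thesis using P(2) mset_subset_eq_count[of "deg P + d" a v] by simp
      qed
      then have "deg ?M \<subseteq># a" unfolding dM by (rule mset_subset_eqI)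
      moreover have "size d = 2 * size M + 1" using M size_deg by auto
      then have "size ?M = Suc k"
        using P(3) szQR size_mset_mono[OF QR(1)]
        unfolding size_add_mset size_union size_Diff_submset[OF QR(1)] by simp
      moreover have "edges ?M" using M eQ uw by auto
      ultimately show ?thesis using max unfolding matchable_def by blast
    next
      case True
      then obtain z where z: "(y, z) \<in> E" "{y, z} \<in># P - Q" using eQ edges_incident by metis
      let ?Q = "add_mset {y, z} Q"
      have Q': "?Q \<subseteq># P" using z(2) QR(1)
        by (metis add_mset_add_single mset_subset_eq_single subset_mset.add_left_mono subset_mset.add_diff_inverse)
      have degQ': "deg ?Q = add_mset z (add_mset y (deg Q))" using mset_set_edge[OF z(1)] by simp
      show ?thesis
      proof (cases "z \<in># deg (N - R)")
        case False
        \<comment> \<open>The walk is stuck at \<open>z\<close>, which has no further edge of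
          \<open>N\<close>. Exchanging \<open>R\<close> for \<open>?Q\<close> in \<open>N\<close>
          gains one edge; the only critical count is at \<open>z\<close>, where it is that of
          \<open>deg ?Q\<close>, bounded through \<open>P\<close>.\<close>
        let ?M = "?Q + (N - R)"
        have dM: "deg ?M = add_mset z (add_mset w (deg N))"
          unfolding deg_simps(3) degQ' yw using dQ QR by (simp add: deg_diff)
        have "count (add_mset z (add_mset w (deg N))) v \<le> count a v" for v
        proof (cases "v = z")
          case True
          have "count (deg N) z = count (deg R) z"
            using False dQ QR by (simp add: deg_diff not_in_iff mset_subset_eq_count antisym)
          then have "count (add_mset z (add_mset w (deg N))) z = count (deg ?Q) z"
            unfolding degQ' yw by simp
          also have "\<dots> \<le> count (deg P + d) z"
            using mset_subset_eq_count[OF deg_mono[OF Q'], of z] unfolding count_union by linarith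
          also have "\<dots> \<le> count a z" using P(2) by (rule mset_subset_eq_count)
          finally show ?thesis using True by simp
        next
          case False
          then show ?thesis using N(3) mset_subset_eq_count[of "add_mset w (deg N)" a v] by simp
        qed
        then have "deg ?M \<subseteq># a" unfolding dM by (rule mset_subset_eqI)
        moreover have "size ?M = Suc k"
          using N(2) szQR size_mset_mono[OF QR(2)]
          unfolding size_add_mset size_union size_Diff_submset[OF QR(2)] by simp
        moreover have "edges ?M" using z eQ by auto
        ultimately show ?thesis using max unfolding matchable_def by blast
      next
        case True
        then obtain z' where z': "(z, z') \<in> E" "{z, z'} \<in># N - R" using eQ edges_incident by metis
        let ?R = "add_mset {z, z'} R"
        have R': "?R \<subseteq># N" using z'(2) QR(2)
          by (metis add_mset_add_single mset_subset_eq_single subset_mset.add_left_mono subset_mset.add_diff_inverse)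
        have "walk (ys @ [z, z'])"
          using ys z z' by (simp add: successively_append_iff y_def)
        moreover have "deg ?Q = mset (butlast (ys @ [z, z']))"
          unfolding degQ' using ys QR
          by (simp add: butlast_append y_def) (metis append_butlast_last_id mset.simps mset_append add.commute union_mset_add_mset_right add.right_neutral)
        moreover have "deg ?R = mset (tl (ys @ [z, z']))"
          using ys QR mset_set_edge[OF z'(1)] by simp
        ultimately show ?thesis using ys Q' R' QR(5)
          by (intro exI[of _ "ys @ [z, z']"] exI[of _ ?Q] exI[of _ ?R]) auto
      qed
    qed
  qed
  from this[of "Suc (size P)"] show False
    by (metis Suc_n_not_le_n size_mset_mono)
qed

text \<open>Starting from a single vertex \<open>v\<close> and a \<open>k\<close>-matching
  \<open>P\<close> that avoids it, \<open>d\<close> absorbs the edges of \<open>P\<close> along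
  alternating walks until its support is \<open>C\<close>. The invariant
  \<open>2 * size P + size d = 2 * k + 1\<close> then bounds \<open>size d\<close>, which in turn
  bounds the cost of the ears.\<close>

theorem ear_built_le_of_critical:
  assumes conn: "connected_on C" and C: "set_mset a = C" "C \<noteq> {}"
    and max: "\<not> matchable (Suc k) a"
    and crit: "\<And>i. i \<in> C \<Longrightarrow> matchable k (a - {#i#})"
  shows "(\<exists>v. C = {v}) \<or> ear_built_le C (2 * k + 1)"
proof -
  \<comment> \<open>A single vertex is not yet ear-built. The first alternating walk returns to it
    and supplies the initial odd cycle through \<open>ear_built_le_closed_walk\<close>; all later
    ones are attached by \<open>ear_built_le_walk\<close>.\<close>
  let ?D = "\<lambda>d. (\<exists>v. d = {#v#}) \<or> ear_built_le (set_mset d) (size d)"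
  have "factor_critical d \<Longrightarrow> ?D d \<Longrightarrow> edges P \<Longrightarrow> deg P + d \<subseteq># a \<Longrightarrow>
    2 * size P + size d = 2 * k + 1 \<Longrightarrow> d \<noteq> {#} \<Longrightarrow> ?thesis" for d P
  proof (induction "card (C - set_mset d)" arbitrary: d P rule: less_induct)
    case less
    note d = less(2) and D = less(3) and P = less(4-6)
    have sub: "set_mset d \<subseteq> C"
      using P(2) C(1) by (metis mset_subset_eq_add_right set_mset_mono subset_mset.order_trans)
    show ?case
    proof (cases "set_mset d = C")
      case True
      moreover have "ear_built_le C (2 * k + 1)" if "ear_built_le C (size d)"
        using that by (rule ear_built_le_mono) (use P(3) in simp)
      ultimately show ?thesis using D by auto
    next
      case False
      then obtain u w where uw: "u \<in># d" "w \<in> C" "w \<notin># d" "(u, w) \<in> E"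
        using conn sub less(7) unfolding connected_on_def
        by (metis DiffE psubsetI set_mset_eq_empty_iff)
      obtain N where N: "edges N" "size N = k" "deg N \<subseteq># a - {#w#}"
        using crit[OF uw(2)] by (auto simp: matchable_def)
      have "add_mset w (deg N) \<subseteq># a" using N(3) uw(2) C(1)
        by (metis insert_subset_eq_iff)
      from alternating_walk[OF P N(1,2) this d uw(1,3,4) max]
      obtain ys Q where ys: "walk ys" "ys \<noteq> []" "hd ys = w" "last ys \<in># d" "Q \<subseteq># P"
        "deg Q = mset (butlast ys)" by blast
      define m where "m = butlast ys"
      define z where "z = last ys"
      have m: "ys = m @ [z]" using ys by (simp add: m_def z_def)
      \<comment> \<open>Prefixing the edge from \<open>u\<close> to \<open>w\<close> gives a walk
        with both ends in \<open>d\<close>. Its inner part \<open>m\<close> is covered exactly by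
        \<open>Q\<close> and therefore has even length.\<close>
      have walk: "walk (u # m @ [z])" using ys uw by (simp add: successively_Cons flip: m)
      have "edges Q" using P(1) ys(5) edges_mono by blast
      then have len: "length m = 2 * size Q"
        using arg_cong[OF ys(6), of size] by (simp add: size_deg m_def)
      have z: "z \<in># d" using ys z_def by simp
      have "w \<in> set m" using ys z uw(3) m by (cases m) auto
      let ?d = "d + mset m"
      have "card (C - set_mset ?d) < card (C - set_mset d)"
        by (rule psubset_card_mono) (use \<open>w \<in> set m\<close> uw C in auto)
      moreover have "factor_critical ?d"
        by (rule factor_critical_walk[OF d walk]) (use len uw z in auto)
      moreover have "?D ?d"
      proof (cases "\<exists>v. d = {#v#}")
        case True
        then obtain v where v: "d = {#v#}" by auto
        then have "ear_built_le (insert v (set m)) (length m + 1)"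
          using walk uw z len by (intro ear_built_le_closed_walk) auto
        then show ?thesis using v by simp
      next
        case False
        with D have "ear_built_le (set_mset d) (size d)" by auto
        from ear_built_le_walk[OF this walk uw(1) z] show ?thesis using len by simp
      qed
      moreover have "edges (P - Q)" using P(1) edges_mono by (meson diff_subset_eq_self)
      moreover have "deg (P - Q) + ?d \<subseteq># a"
      proof -
        have "deg (P - Q) + ?d = deg P - deg Q + deg Q + d"
          using ys by (simp add: deg_diff m_def)
        also have "\<dots> = deg P + d" using deg_mono[OF ys(5)] by simp
        finally show ?thesis using P(2) by (simp only:)
      qed
      moreover have "2 * size (P - Q) + size ?d = 2 * k + 1"
        using P(3) len size_mset_mono[OF ys(5)] by (simp add: size_Diff_submset[OF ys(5)])
      ultimately show ?thesis using less(7) by (intro less(1)[of ?d "P - Q"]) auto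
    qed
  qed
  moreover obtain v where v: "v \<in> C" using C(2) by auto
  then obtain P where "edges P" "size P = k" "deg P \<subseteq># a - {#v#}"
    using crit by (auto simp: matchable_def)
  moreover from this have "deg P + {#v#} \<subseteq># a"
    using v C(1) by (metis add_mset_add_single insert_subset_eq_iff)
  ultimately show ?thesis using factor_critical_single[of v] by (metis add_mset_not_empty size_single)
qed

end


section \<open>Matchings in the components of a graph\<close>

lemma filter_mset_empty: "(\<And>x. x \<in># M \<Longrightarrow> \<not> p x) \<Longrightarrow> filter_mset p M = {#}"
  by (induction M) auto

context sym_irrefl
begin

lemma matchable_le:
  assumes "matchable k a" "l \<le> k"
  shows "matchable l a"
  using assms(2,1) by (induction rule: inc_induct) (auto dest: matchable_Suc)

lemma matchable_sum:
  "finite A \<Longrightarrow> (\<And>x. x \<in> A \<Longrightarrow> matchable (f x) (g x)) \<Longrightarrow> matchable (sum f A) (sum g A)"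
  by (induction rule: finite_induct) (simp_all add: matchable_add)

lemma edges_filter: "edges M \<Longrightarrow> edges (filter_mset p M)"
  by (rule edges_mono) auto

lemma deg_filter:
  assumes "edges M" "\<And>e. e \<in># M \<Longrightarrow> e \<subseteq> C \<or> e \<inter> C = {}"
  shows "deg (filter_mset (\<lambda>e. e \<subseteq> C) M) = filter_mset (\<lambda>v. v \<in> C) (deg M)"
  using assms
proof (induction M)
  case (add e M)
  then obtain x y where e: "(x, y) \<in> E" "e = {x, y}" by auto
  moreover have "e \<subseteq> C \<or> e \<inter> C = {}" using add(3)[of e] by simp
  ultimately show ?case using add(1,2,3) by (auto simp: mset_set_edge simp del: mset_set.insert)
qed simp

text \<open>These properties characterise the vertex sets of the connected components of the
  subgraph on \<open>U\<close>, independently of any digraph structure.\<close>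

definition components :: "'v set \<Rightarrow> 'v set set \<Rightarrow> bool" where
  "components U \<C> \<longleftrightarrow> finite U \<and> \<Union>\<C> = U \<and> (\<forall>C \<in> \<C>. C \<noteq> {} \<and> connected_on C) \<and>
     (\<forall>C \<in> \<C>. \<forall>D \<in> \<C>. C \<noteq> D \<longrightarrow> C \<inter> D = {}) \<and>
     (\<forall>C \<in> \<C>. \<forall>x \<in> C. \<forall>y \<in> U. (x, y) \<in> E \<longrightarrow> y \<in> C)"

lemma components_closed:
  "components U \<C> \<Longrightarrow> C \<in> \<C> \<Longrightarrow> x \<in> C \<Longrightarrow> y \<in> U \<Longrightarrow> (x, y) \<in> E \<Longrightarrow> y \<in> C"
  by (simp add: components_def)

lemma components_disjoint:
  "components U \<C> \<Longrightarrow> C \<in> \<C> \<Longrightarrow> D \<in> \<C> \<Longrightarrow> C \<noteq> D \<Longrightarrow> C \<inter> D = {}"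
  by (simp add: components_def)

lemma finite_components: "components U \<C> \<Longrightarrow> finite \<C>"
  using finite_UnionD[of \<C>] by (auto simp: components_def)

lemma edge_subset_deg:
  assumes "edges M" "e \<in># M"
  obtains x y where "(x, y) \<in> E" "e = {x, y}" "x \<in># deg M" "y \<in># deg M"
proof -
  obtain x y where xy: "(x, y) \<in> E" "e = {x, y}" using assms by (auto simp: edges_def)
  moreover have "deg {#e#} \<subseteq># deg M" using assms by (intro deg_mono) auto
  then have "{#x, y#} \<subseteq># deg M" using xy by (simp add: mset_set_edge)
  then have "x \<in># deg M" "y \<in># deg M" by (auto dest: mset_subset_eqD)
  ultimately show ?thesis using that by blast
qed

lemma components_edge:
  assumes "components U \<C>" "edges M" "set_mset (deg M) \<subseteq> U" "e \<in># M"
  shows "\<exists>!C. C \<in> \<C> \<and> e \<subseteq> C" and "C \<in> \<C> \<Longrightarrow> e \<subseteq> C \<or> e \<inter> C = {}"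
proof -
  obtain x y where xy: "(x, y) \<in> E" "e = {x, y}" "x \<in># deg M" "y \<in># deg M"
    using edge_subset_deg assms(2,4) by metis
  then have U: "x \<in> U" "y \<in> U" using assms by auto
  then obtain C where C: "C \<in> \<C>" "x \<in> C" using assms(1) unfolding components_def by auto
  then have "y \<in> C" using components_closed[OF assms(1)] U xy(1) by blast
  then have eC: "e \<subseteq> C" using xy C by auto
  have uniq: "D = C" if "D \<in> \<C>" "e \<inter> D \<noteq> {}" for D
    using components_disjoint[OF assms(1) that(1) C(1)] that(2) eC by blast
  show "\<exists>!C. C \<in> \<C> \<and> e \<subseteq> C"
  proof (rule ex1I[of _ C])
    fix D assume D: "D \<in> \<C> \<and> e \<subseteq> D"
    then have "x \<in> e \<inter> D" using xy by auto
    then show "D = C" using uniq D by blast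
  qed (use eC C in blast)
  show "e \<subseteq> D \<or> e \<inter> D = {}" if "D \<in> \<C>" for D using uniq[OF that] eC by blast
qed

lemma sum_size_filter:
  assumes "finite A" "\<And>e. e \<in># M \<Longrightarrow> \<exists>!C. C \<in> A \<and> P C e"
  shows "(\<Sum>C\<in>A. size (filter_mset (P C) M)) = size M"
  using assms(2)
proof (induction M)
  case (add e M)
  have ex1: "\<exists>!C. C \<in> A \<and> P C e" using add(2) by simp
  then obtain D where D: "D \<in> A" "P D e" by blast
  have uniq: "P C e \<longleftrightarrow> C = D" if "C \<in> A" for C using ex1 D that by blast
  have "(\<Sum>C\<in>A. size (filter_mset (P C) (add_mset e M))) =
      (\<Sum>C\<in>A. size (filter_mset (P C) M) + (if C = D then 1 else 0))"
    using uniq by (intro sum.cong) simp_all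
  also have "\<dots> = size M + 1" using add D(1) assms(1) by (simp add: sum.distrib)
  finally show ?case by simp
qed simp

lemma sum_size_components:
  assumes "components U \<C>" "edges M" "set_mset (deg M) \<subseteq> U"
  shows "(\<Sum>C\<in>\<C>. size (filter_mset (\<lambda>e. e \<subseteq> C) M)) = size M"
  by (rule sum_size_filter[OF finite_components[OF assms(1)] components_edge(1)[OF assms]])

lemma deg_filter_component:
  assumes "components U \<C>" "edges M" "set_mset (deg M) \<subseteq> U" "C \<in> \<C>"
  shows "deg (filter_mset (\<lambda>e. e \<subseteq> C) M) = filter_mset (\<lambda>v. v \<in> C) (deg M)"
  by (rule deg_filter[OF assms(2) components_edge(2)[OF assms(1-3) _ assms(4)]])

text \<open>All \<open>s\<close>-matchings of \<open>c\<close> have the same number of edges in a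
  given component, by exchange. Hence the restriction of \<open>c\<close> to each component is
  itself critical, with \<open>k C\<close> the number of edges of a fixed \<open>M\<close> in
  \<open>C\<close>. Neighbours within \<open>U\<close> exclude one-vertex components.\<close>

lemma critical_components:
  assumes comp: "components U \<C>" and U: "set_mset c = U"
    and max: "\<not> matchable (Suc s) c"
    and crit: "\<And>i. i \<in> U \<Longrightarrow> matchable s (c - {#i#})"
    and nbr: "\<And>i. i \<in> U \<Longrightarrow> \<exists>j\<in>U. (i, j) \<in> E"
  shows "\<exists>k. (\<forall>C\<in>\<C>. ear_built_le C (2 * k C + 1)) \<and> sum k \<C> \<le> s"
proof (cases "U = {}")
  case True
  then have "\<C> = {}" using comp unfolding components_def by auto
  then show ?thesis by auto
next
  case False
  then obtain i where "i \<in> U" by auto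
  then obtain M where M: "edges M" "size M = s" "deg M \<subseteq># c"
    using crit unfolding matchable_def by (meson diff_subset_eq_self subset_mset.order_trans)
  define split where "split M C = filter_mset (\<lambda>e. e \<subseteq> C) M" for M :: "'v set multiset" and C
  \<comment> \<open>Otherwise replacing the edges of \<open>N\<close> inside \<open>C\<close> by
    those of \<open>N'\<close> would give more than \<open>s\<close> edges.\<close>
  have exchange: "size (split N C) \<ge> size (split N' C)"
    if N: "edges N" "size N = s" "deg N \<subseteq># c" and N': "edges N'" "deg N' \<subseteq># c" and C: "C \<in> \<C>"
    for N N' C
  proof (rule ccontr)
    assume less: "\<not> ?thesis"
    define K where "K = filter_mset (\<lambda>e. \<not> e \<subseteq> C) N"
    have NK: "N = split N C + K" by (simp add: split_def K_def)
    have sub: "set_mset (deg N) \<subseteq> U" "set_mset (deg N') \<subseteq> U"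
      using N(3) N'(2) U set_mset_mono by blast+
    have d: "deg (split N C) = filter_mset (\<lambda>v. v \<in> C) (deg N)"
      "deg (split N' C) = filter_mset (\<lambda>v. v \<in> C) (deg N')"
      unfolding split_def using deg_filter_component[OF comp _ _ C] N N' sub by blast+
    have "deg N = deg (split N C) + deg K" by (subst NK) simp
    then have dK: "deg K = filter_mset (\<lambda>v. v \<notin> C) (deg N)"
      unfolding d by (metis add_diff_cancel_left' multiset_partition)
    have "deg (split N' C + K) \<subseteq># filter_mset (\<lambda>v. v \<in> C) c + filter_mset (\<lambda>v. v \<notin> C) c"
      unfolding deg_simps d dK using N N' by (intro subset_mset.add_mono multiset_filter_mono)
    then have "deg (split N' C + K) \<subseteq># c" by (metis multiset_partition)
    moreover have "edges (split N' C + K)"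
      using N N' by (simp add: split_def K_def edges_filter)
    moreover have "Suc s \<le> size (split N' C + K)"
      using less N(2) arg_cong[OF NK, of size] by simp
    ultimately show False using max matchable_le unfolding matchable_def by blast
  qed
  let ?k = "\<lambda>C. size (split M C)"
  have "ear_built_le C (2 * ?k C + 1)" if C: "C \<in> \<C>" for C
  proof -
    let ?c = "filter_mset (\<lambda>v. v \<in> C) c"
    have CU: "C \<subseteq> U" "C \<noteq> {}" "connected_on C" using C comp unfolding components_def by auto
    have "(\<exists>v. C = {v}) \<or> ear_built_le C (2 * ?k C + 1)"
    proof (rule ear_built_le_of_critical)
      show "set_mset ?c = C" using CU U by auto
      show "\<not> matchable (Suc (?k C)) ?c"
      proof
        assume "matchable (Suc (?k C)) ?c"
        then obtain N where N: "edges N" "size N = Suc (?k C)" "deg N \<subseteq># ?c"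
          by (auto simp: matchable_def)
        have "e \<subseteq> C" if "e \<in># N" for e
        proof -
          obtain x y where "e = {x, y}" "x \<in># deg N" "y \<in># deg N"
            using edge_subset_deg[OF N(1) \<open>e \<in># N\<close>] by metis
          then show ?thesis using set_mset_mono[OF N(3)] by auto
        qed
        then have "split N C = N" unfolding split_def by (auto simp: filter_mset_eq_conv)
        moreover have "deg N \<subseteq># c" using N(3) multiset_filter_subset subset_mset.order_trans by blast
        ultimately show False using exchange[OF M N(1) _ C] N(2) by simp
      qed
      show "matchable (?k C) (?c - {#i#})" if i: "i \<in> C" for i
      proof -
        obtain N where N: "edges N" "size N = s" "deg N \<subseteq># c - {#i#}"
          using crit i CU by (auto simp: matchable_def)
        have Nc: "deg N \<subseteq># c" using N(3) by (meson diff_subset_eq_self subset_mset.order_trans)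
        then have "set_mset (deg N) \<subseteq> U" using U set_mset_mono by blast
        then have "deg (split N C) = filter_mset (\<lambda>v. v \<in> C) (deg N)"
          unfolding split_def by (rule deg_filter_component[OF comp N(1) _ C])
        also have "\<dots> \<subseteq># filter_mset (\<lambda>v. v \<in> C) (c - {#i#})"
          using N(3) by (rule multiset_filter_mono)
        also have "\<dots> = ?c - {#i#}" using i by simp
        finally have "deg (split N C) \<subseteq># ?c - {#i#}" .
        moreover have "edges (split N C)" unfolding split_def using N(1) by (rule edges_filter)
        ultimately have "matchable (size (split N C)) (?c - {#i#})"
          unfolding matchable_def by auto
        moreover have "?k C \<le> size (split N C)" by (rule exchange[OF N(1,2) Nc M(1,3) C])
        ultimately show ?thesis by (rule matchable_le)
      qed
    qed (use CU in auto)
    moreover have "C \<noteq> {v}" for v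
    proof
      assume v: "C = {v}"
      then have "v \<in> U" using CU by blast
      then obtain j where "j \<in> U" "(v, j) \<in> E" using nbr by blast
      then have "j = v" using v components_closed[OF comp C] by blast
      then show False using \<open>(v, j) \<in> E\<close> adj_irrefl by simp
    qed
    ultimately show ?thesis by auto
  qed
  moreover have "set_mset (deg M) \<subseteq> U" using M(3) U set_mset_mono by blast
  then have "sum ?k \<C> = s" unfolding split_def using sum_size_components[OF comp M(1)] M(2) by simp
  ultimately show ?thesis by (intro exI[of _ ?k]) auto
qed

end

section \<open>Exponent vectors whose colon ideal is \<open>P\<^sub>F\<close>\<close>

locale covered_graph = sym_irrefl E for E :: "('v \<times> 'v) set" +
  fixes V F :: "'v set"
  assumes fin: "finite V" and E_sub: "E \<subseteq> V \<times> V" and F_sub: "F \<subseteq> V"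
    and cover: "(x, y) \<in> E \<Longrightarrow> x \<in> F \<or> y \<in> F"
begin

text \<open>Means \<open>I\<^sup>t : x\<^sup>a = P\<^sub>F\<close>.\<close>

definition witness :: "nat \<Rightarrow> 'v multiset \<Rightarrow> bool" where
  "witness t a \<longleftrightarrow> set_mset a \<subseteq> V \<and> (\<forall>i\<in>F. matchable t (add_mset i a)) \<and>
     (\<forall>b. set_mset b \<subseteq> V - F \<longrightarrow> \<not> matchable t (a + b))"

text \<open>For the least \<open>t'\<close> that has a witness \<open>a\<close>, deleting
  \<open>i\<close> from \<open>a\<close> cannot give a witness for \<open>t' - 1\<close>. By
  \<open>matchable_drop_vertex\<close> the only condition that can fail is the last, so
  \<open>a - {#i#}\<close> with suitable vertices outside \<open>F\<close> still carries
  \<open>t' - 1\<close> edges. An edge from \<open>i\<close> in \<open>F\<close> out of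
  \<open>F\<close> would then add one more, which is forbidden. \<open>c\<close> is the part of
  \<open>a\<close> inside \<open>F\<close>.\<close>

lemma witness_imp_critical:
  assumes "witness t a"
  shows "\<exists>s c. s < t \<and> set_mset c \<subseteq> F \<and> \<not> matchable (Suc s) c \<and>
    (\<forall>i \<in># c. matchable s (c - {#i#}) \<and> (\<forall>y. (i, y) \<in> E \<longrightarrow> y \<in> F)) \<and>
    (\<forall>l \<in> F. \<exists>y. (l, y) \<in> E \<and> (y \<in># c \<or> y \<in> V - F))"
proof -
  define t' where "t' = (LEAST t. \<exists>a. witness t a)"
  have "\<exists>a. witness t' a" unfolding t'_def by (rule LeastI_ex) (use assms in blast)
  then obtain a where a: "witness t' a" by auto
  have "t' \<le> t" unfolding t'_def by (rule Least_le) (use assms in blast)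
  have min: "\<not> witness s b" if "s < t'" for s b
    using that not_less_Least unfolding t'_def by blast
  have "\<not> matchable t' (a + {#})"
    using a unfolding witness_def by (metis empty_subsetI set_mset_empty)
  then have "t' \<noteq> 0" by (metis matchable_0)
  then obtain s where s: "t' = Suc s" by (cases t') auto
  have aV: "set_mset a \<subseteq> V" and aF: "\<And>l. l \<in> F \<Longrightarrow> matchable (Suc s) (add_mset l a)"
    and amax: "\<And>b. set_mset b \<subseteq> V - F \<Longrightarrow> \<not> matchable (Suc s) (a + b)"
    using a s by (auto simp: witness_def)
  have "\<exists>b. set_mset b \<subseteq> V - F \<and> matchable s (a - {#i#} + b)" if i: "i \<in># a" for i
  proof -
    have "matchable s (add_mset l (a - {#i#}))" if "l \<in> F" for l
    proof -
      have "add_mset l a = add_mset i (add_mset l (a - {#i#}))"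
        using i by (simp add: add_mset_commute)
      then show ?thesis using aF[OF that] matchable_drop_vertex by metis
    qed
    moreover have "set_mset (a - {#i#}) \<subseteq> V" using aV by (meson in_diffD subset_iff)
    moreover have "\<not> witness s (a - {#i#})" using min s by simp
    ultimately show ?thesis by (auto simp: witness_def)
  qed
  then obtain b where b: "\<And>i. i \<in># a \<Longrightarrow> set_mset (b i) \<subseteq> V - F"
    "\<And>i. i \<in># a \<Longrightarrow> matchable s (a - {#i#} + b i)" by metis
  \<comment> \<open>The sum serves all \<open>i\<close> at once, since it contains every
    \<open>b i\<close> and still avoids \<open>F\<close>.\<close>
  define B where "B = (\<Sum>i\<in>set_mset a. b i)"
  have B: "set_mset B \<subseteq> V - F" unfolding B_def using b(1) by (auto simp: set_mset_sum)
  have bB: "matchable s (a - {#i#} + B)" if "i \<in># a" for i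
  proof -
    have "b i \<subseteq># B" unfolding B_def using that by (simp add: sum.remove[of _ i])
    then show ?thesis using b(2)[OF that] matchable_mono by (metis subset_mset.add_left_mono)
  qed
  define c where "c = filter_mset (\<lambda>v. v \<in> F) a"
  have c_in: "i \<in># c \<longleftrightarrow> i \<in># a \<and> i \<in> F" for i by (simp add: c_def)
  have nonadj: "y \<in> F" if "i \<in># c" "(i, y) \<in> E" for i y
  proof (rule ccontr)
    assume "y \<notin> F"
    then have "set_mset (add_mset y B) \<subseteq> V - F" using that E_sub B by auto
    moreover have "matchable (s + 1) (a - {#i#} + B + {#i, y#})"
      using bB that c_in matchable_edge by (intro matchable_add) auto
    moreover have "a - {#i#} + B + {#i, y#} = a + add_mset y B" using that c_in by simp
    ultimately show False using amax[of "add_mset y B"] by (metis Suc_eq_plus1)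
  qed
  have "matchable s (c - {#i#})" if i: "i \<in># c" for i
  proof -
    obtain M where M: "edges M" "size M = s" "deg M \<subseteq># a - {#i#} + B"
      using bB i c_in by (auto simp: matchable_def)
    have "v \<in> F" if v: "v \<in># deg M" for v
    proof (rule ccontr)
      assume vF: "v \<notin> F"
      obtain z where z: "(v, z) \<in> E" "{v, z} \<in># M" using edges_incident[OF M(1) v] .
      then have zF: "z \<in> F" using vF cover by auto
      have "z \<in># deg M" using edge_subset_deg[OF M(1) z(2)] by (metis doubleton_eq_iff)
      then have "z \<in># a - {#i#} + B" using M(3) mset_subset_eqD by metis
      then have "z \<in># c" using zF B c_in by (auto dest: in_diffD)
      then show False using nonadj adj_sym z(1) vF by blast
    qed
    then have "deg M = filter_mset (\<lambda>v. v \<in> F) (deg M)" by (metis filter_mset_eq_conv filter_mset_True filter_mset_cong)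
    also have "\<dots> \<subseteq># filter_mset (\<lambda>v. v \<in> F) (a - {#i#} + B)" using M(3) by (rule multiset_filter_mono)
    also have "\<dots> = c - {#i#}"
    proof -
      have B0: "filter_mset (\<lambda>v. v \<in> F) B = {#}" using B by (auto intro!: filter_mset_empty)
      show ?thesis using i c_in by (simp add: c_def B0)
    qed
    finally show ?thesis using M by (auto simp: matchable_def)
  qed
  moreover have "\<exists>y. (l, y) \<in> E \<and> (y \<in># c \<or> y \<in> V - F)" if l: "l \<in> F" for l
  proof -
    obtain M where M: "edges M" "size M = Suc s" "deg M \<subseteq># add_mset l a"
      using aF[OF l] by (auto simp: matchable_def)
    \<comment> \<open>Hence \<open>M\<close> uses the added copy of \<open>l\<close>, and the
      partner of \<open>l\<close> is a vertex of \<open>a\<close>.\<close>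
    have "\<not> deg M \<subseteq># a" using amax[of "{#}"] M by (auto simp: matchable_def)
    then have "l \<in># deg M" using M(3) by (metis insert_DiffM2 inter_add_right1 subset_mset.le_iff_inf)
    then obtain z where z: "(l, z) \<in> E" "{l, z} \<in># M" using edges_incident[OF M(1)] by metis
    have "z \<in># deg M" using edge_subset_deg[OF M(1) z(2)] by (metis doubleton_eq_iff)
    then have "z \<in># add_mset l a" using M(3) mset_subset_eqD by metis
    moreover have "z \<noteq> l" using z(1) adj_irrefl by auto
    ultimately have "z \<in># a" by simp
    then show ?thesis using z(1) E_sub by (auto simp: c_in intro!: exI[of _ z])
  qed
  moreover have "\<not> matchable (Suc s) c"
    using amax[of "{#}"] matchable_mono[of "Suc s" c a] by (auto simp: c_def)
  moreover have "set_mset c \<subseteq> F" using c_in by auto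
  ultimately show ?thesis using nonadj s \<open>t' \<le> t\<close> by (intro exI[of _ s] exI[of _ c]) auto
qed

lemma size_le_cover:
  "edges M \<Longrightarrow> size M \<le> size (filter_mset (\<lambda>v. v \<in> F) (deg M))"
proof (induction M)
  case (add e M)
  then obtain x y where "(x, y) \<in> E" "e = {x, y}" by auto
  then show ?case using add cover[of x y] by (auto simp: mset_set_edge simp del: mset_set.insert)
qed simp

lemma matchable_replicate:
  "(x, y) \<in> E \<Longrightarrow> matchable k (replicate_mset k x + replicate_mset k y)"
proof (induction k)
  case (Suc k)
  then have "matchable (1 + k) ({#x, y#} + (replicate_mset k x + replicate_mset k y))"
    by (intro matchable_add matchable_edge) auto
  then show ?case by (simp add: add_mset_commute)
qed simp

text \<open>Every edge consumes a vertex of \<open>F\<close>. With \<open>t - 1\<close> copies of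
  one \<open>i\<close> in \<open>F\<close> and many copies of all vertices outside, exactly
  \<open>t - 1\<close> edges fit, and any further vertex of \<open>F\<close> brings an edge to the
  outside. If \<open>F\<close> is empty there are no edges at all.\<close>

lemma witness_minimal_cover:
  assumes min: "\<And>i. i \<in> F \<Longrightarrow> \<exists>y \<in> V - F. (i, y) \<in> E" and "t \<ge> 1"
  shows "\<exists>a. witness t a"
proof (cases "F = {}")
  case True
  have "\<not> matchable t b" for b
    using size_le_cover True assms(2) by (fastforce simp: matchable_def)
  then show ?thesis unfolding witness_def using True by (intro exI[of _ "{#}"]) auto
next
  case False
  then obtain i where i: "i \<in> F" by auto
  then obtain y where y: "y \<in> V - F" "(i, y) \<in> E" using min by auto
  let ?b = "repeat_mset t (mset_set (V - F))"
  let ?a = "replicate_mset (t - 1) i + ?b"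
  have "matchable t (add_mset l ?a)" if l: "l \<in> F" for l
  proof -
    obtain z where z: "z \<in> V - F" "(l, z) \<in> E" using min l by auto
    have "matchable ((t - 1) + 1) (replicate_mset (t - 1) i + replicate_mset (t - 1) y + {#l, z#})"
      by (intro matchable_add matchable_replicate matchable_edge y z)
    \<comment> \<open>\<open>t\<close> copies of each outside vertex suffice even if
      \<open>z = y\<close>.\<close>
    moreover have "add_mset z (replicate_mset (t - 1) y) \<subseteq># ?b"
      using y z fin assms(2) by (auto intro!: mset_subset_eqI)
    then have "replicate_mset (t - 1) i + replicate_mset (t - 1) y + {#l, z#} \<subseteq># add_mset l ?a"
      by simp
    ultimately show ?thesis using assms(2) matchable_mono by simp
  qed
  moreover have "\<not> matchable t (?a + b)" if b: "set_mset b \<subseteq> V - F" for b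
  proof
    assume "matchable t (?a + b)"
    then obtain M where M: "edges M" "size M = t" "deg M \<subseteq># ?a + b" by (auto simp: matchable_def)
    have "size M \<le> size (filter_mset (\<lambda>v. v \<in> F) (deg M))" using M(1) by (rule size_le_cover)
    also have "\<dots> \<le> size (filter_mset (\<lambda>v. v \<in> F) (?a + b))"
      using M(3) by (intro size_mset_mono multiset_filter_mono)
    also have "filter_mset (\<lambda>v. v \<in> F) (?a + b) = replicate_mset (t - 1) i"
      using b i fin by (auto simp: multiset_eq_iff not_in_iff)
    finally show False using M(2) assms(2) by simp
  qed
  moreover have "x \<in> V" if "x \<in># ?b" for x
  proof -
    have "0 < t * count (mset_set (V - F)) x"
      using that by (metis count_greater_zero_iff count_repeat_mset)
    then have "x \<in># mset_set (V - F)" by simp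
    then show ?thesis using fin by simp
  qed
  then have "set_mset ?a \<subseteq> V" using i F_sub by (auto split: if_splits)
  ultimately show ?thesis unfolding witness_def by blast
qed

text \<open>A component holds at most \<open>size (d C) div 2\<close> edges, and still that many
  after deletion of any vertex. A new \<open>i\<close> in \<open>F\<close> gains an edge by joining
  it to a vertex \<open>j\<close> of \<open>U\<close>, spared by its component, or to one outside
  \<open>F\<close>. Vertices outside \<open>F\<close> gain nothing, as none of their neighbours is
  present.\<close>

lemma witness_factor_critical:
  assumes comp: "components U \<C>"
    and d: "\<And>C. C \<in> \<C> \<Longrightarrow> factor_critical (d C) \<and> set_mset (d C) = C \<and> 2 \<le> size (d C)"
    and t: "t = Suc (\<Sum>C\<in>\<C>. size (d C) div 2)"
    and UF: "U \<subseteq> F" "\<And>u y. u \<in> U \<Longrightarrow> (u, y) \<in> E \<Longrightarrow> y \<in> F"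
    and min: "\<And>i. i \<in> F \<Longrightarrow> i \<notin> U \<Longrightarrow> \<exists>y \<in> U \<union> (V - F). (i, y) \<in> E"
  shows "witness t (sum d \<C> + mset_set (V - F))"
proof -
  have fC: "finite \<C>" using comp by (rule finite_components)
  have setd: "set_mset (sum d \<C>) = U"
    using d comp fC unfolding components_def by (auto simp: set_mset_sum)
  have filt: "filter_mset (\<lambda>v. v \<in> C) (sum d \<C>) = d C" if C: "C \<in> \<C>" for C
  proof -
    have "filter_mset (\<lambda>v. v \<in> C) (sum d \<C>) = (\<Sum>D\<in>\<C>. filter_mset (\<lambda>v. v \<in> C) (d D))"
      using fC by (induction rule: finite_induct) auto
    also have "\<dots> = (\<Sum>D\<in>\<C>. if D = C then d C else {#})"
    proof (intro sum.cong refl)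
      fix D assume D: "D \<in> \<C>"
      show "filter_mset (\<lambda>v. v \<in> C) (d D) = (if D = C then d C else {#})"
      proof (cases "D = C")
        case True
        then show ?thesis using d[OF C] by (simp add: filter_mset_eq_conv)
      next
        case False
        then have "C \<inter> D = {}" using C D comp unfolding components_def by blast
        then show ?thesis using d[OF D] False by (auto intro!: filter_mset_empty)
      qed
    qed
    also have "\<dots> = d C" using fC C by simp
    finally show ?thesis .
  qed
  have near: "matchable (size (d C) div 2) (d C - {#j#})" if C: "C \<in> \<C>" and j: "j \<in> C" for C j
  proof -
    obtain M where M: "edges M" "add_mset j (deg M) = d C"
      using d[OF C] j unfolding factor_critical_def by blast
    have "size M = size (d C) div 2" "deg M = d C - {#j#}"
      using size_deg[OF M(1)] by (simp_all flip: M(2))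
    then show ?thesis unfolding matchable_def using M(1) by auto
  qed
  have full: "matchable (size (d C) div 2) (d C)" if C: "C \<in> \<C>" for C
  proof -
    have "C \<noteq> {}" using comp C unfolding components_def by auto
    then show ?thesis using near[OF C] matchable_mono diff_subset_eq_self by blast
  qed
  have "matchable t (add_mset i (sum d \<C> + mset_set (V - F)))" if i: "i \<in> F" for i
  proof -
    consider j where "j \<in> U" "(i, j) \<in> E" | y where "y \<in> V - F" "(i, y) \<in> E"
    proof (cases "i \<in> U")
      case True
      then obtain C where C: "C \<in> \<C>" "i \<in> C" using comp unfolding components_def by auto
      then obtain j where "j \<in># d C" "(i, j) \<in> E"
        using factor_critical_neighbour[of "d C" i] d[OF C(1)] by auto
      then have "j \<in> U" using d[OF C(1)] C comp unfolding components_def by auto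
      then show ?thesis using that \<open>(i, j) \<in> E\<close> by blast
    qed (use min i that in blast)
    then show ?thesis
    proof cases
      case 1
      then obtain C where C: "C \<in> \<C>" "j \<in> C" using comp unfolding components_def by auto
      \<comment> \<open>One copy of \<open>j\<close> is withheld from its component and paired with
        \<open>i\<close>.\<close>
      let ?d = "\<lambda>D. if D = C then d C - {#j#} else d D"
      have "matchable (\<Sum>C\<in>\<C>. size (d C) div 2) (sum ?d \<C>)"
        using fC near full C by (intro matchable_sum) auto
      then have "matchable ((\<Sum>C\<in>\<C>. size (d C) div 2) + 1) (sum ?d \<C> + {#i, j#})"
        using 1 matchable_edge matchable_add by blast
      moreover have "sum ?d \<C> + {#i, j#} = add_mset i (sum d \<C>)"
      proof -
        have "sum ?d \<C> = d C - {#j#} + sum d (\<C> - {C})"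
          using fC C by (simp add: sum.remove[of _ C])
        moreover have "sum d \<C> = d C + sum d (\<C> - {C})" using fC C by (simp add: sum.remove[of _ C])
        moreover have "j \<in># d C" using C d by auto
        ultimately show ?thesis by simp
      qed
      ultimately show ?thesis using t matchable_mono[of t "add_mset i (sum d \<C>)"] by simp
    next
      case 2
      have "matchable ((\<Sum>C\<in>\<C>. size (d C) div 2) + 1) (sum d \<C> + {#i, y#})"
        using fC full 2 by (intro matchable_add matchable_sum matchable_edge) auto
      moreover have "{#y#} \<subseteq># mset_set (V - F)" using 2 fin by simp
      then have "sum d \<C> + {#i, y#} \<subseteq># add_mset i (sum d \<C> + mset_set (V - F))" by simp
      ultimately show ?thesis using t matchable_mono by simp
    qed
  qed
  moreover have "\<not> matchable t (sum d \<C> + mset_set (V - F) + b)" if b: "set_mset b \<subseteq> V - F" for b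
  proof
    let ?a = "sum d \<C> + mset_set (V - F) + b"
    assume "matchable t ?a"
    then obtain M where M: "edges M" "size M = t" "deg M \<subseteq># ?a" by (auto simp: matchable_def)
    have in_a: "v \<in> U \<or> v \<in> V - F" if "v \<in># deg M" for v
    proof -
      have "v \<in># ?a" using that M(3) mset_subset_eqD by metis
      then show ?thesis using b setd fin by auto
    qed
    \<comment> \<open>No edge joins two vertices outside \<open>F\<close>, and none joins
      \<open>U\<close> to the outside.\<close>
    have sub: "set_mset (deg M) \<subseteq> U"
    proof
      fix v assume v: "v \<in># deg M"
      obtain z where z: "(v, z) \<in> E" "{v, z} \<in># M" using edges_incident[OF M(1) v] .
      have "z \<in># deg M" using edge_subset_deg[OF M(1) z(2)] by (metis doubleton_eq_iff)
      then show "v \<in> U" using in_a[OF v] in_a[of z] cover z(1) UF(2) adj_sym by blast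
    qed
    have "size (filter_mset (\<lambda>e. e \<subseteq> C) M) \<le> size (d C) div 2" if C: "C \<in> \<C>" for C
    proof -
      have "2 * size (filter_mset (\<lambda>e. e \<subseteq> C) M) = size (deg (filter_mset (\<lambda>e. e \<subseteq> C) M))"
        using M(1) by (simp add: size_deg edges_filter)
      also have "\<dots> = size (filter_mset (\<lambda>v. v \<in> C) (deg M))"
        using deg_filter_component[OF comp M(1) sub C] by simp
      also have "\<dots> \<le> size (filter_mset (\<lambda>v. v \<in> C) ?a)"
        using M(3) by (intro size_mset_mono multiset_filter_mono)
      also have "filter_mset (\<lambda>v. v \<in> C) ?a = d C"
      proof -
        have "C \<subseteq> F" using comp C UF unfolding components_def by auto
        then have "filter_mset (\<lambda>v. v \<in> C) (mset_set (V - F)) = {#}"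
          "filter_mset (\<lambda>v. v \<in> C) b = {#}"
          using b fin by (intro filter_mset_empty; auto)+
        then show ?thesis using filt[OF C] by simp
      qed
      finally show ?thesis by simp
    qed
    then have "size M \<le> (\<Sum>C\<in>\<C>. size (d C) div 2)"
      unfolding sum_size_components[OF comp M(1) sub, symmetric] by (rule sum_mono)
    then show False using t M(2) by simp
  qed
  moreover have "set_mset (sum d \<C> + mset_set (V - F)) \<subseteq> V"
    using setd UF F_sub fin by auto
  ultimately show ?thesis unfolding witness_def by auto
qed

end


section \<open>Monomial ideals and associated primes\<close>

definition mset_of :: "('v \<Rightarrow>\<^sub>0 nat) \<Rightarrow> 'v multiset" where
  "mset_of m = Abs_multiset (Poly_Mapping.lookup m)"

lemma count_mset_of [simp]: "count (mset_of m) v = Poly_Mapping.lookup m v"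
  unfolding mset_of_def by (subst Abs_multiset_inverse) simp_all

lemma set_mset_of [simp]: "set_mset (mset_of m) = Poly_Mapping.keys m"
  by (auto simp: set_mset_def keys.rep_eq)

lemma mset_of_add [simp]: "mset_of (m + m') = mset_of m + mset_of m'"
  by (rule multiset_eqI) (simp add: lookup_add)

lemma mset_of_zero [simp]: "mset_of 0 = {#}"
  by (rule multiset_eqI) simp

lemma mset_of_single [simp]: "mset_of (Poly_Mapping.single i (Suc 0)) = {#i#}"
  by (rule multiset_eqI) (simp add: lookup_single when_def)

lemma mset_of_inject: "mset_of m = mset_of m' \<Longrightarrow> m = m'"
  by (rule poly_mapping_eqI) (metis count_mset_of)

lemma ex_mset_of: "\<exists>m. mset_of m = a"
proof (induction a)
  case (add i a)
  then obtain m where "mset_of m = a" by auto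
  then have "mset_of (Poly_Mapping.single i 1 + m) = add_mset i a" by simp
  then show ?case by blast
qed (use mset_of_zero in blast)

definition expo :: "'v multiset \<Rightarrow> ('v \<Rightarrow>\<^sub>0 nat)" where
  "expo a = (SOME m. mset_of m = a)"

lemma mset_of_expo [simp]: "mset_of (expo a) = a"
  unfolding expo_def by (rule someI_ex[OF ex_mset_of])

lemma poly_mapping_sum_single:
  "p = (\<Sum>m \<in> Poly_Mapping.keys p. Poly_Mapping.single m (Poly_Mapping.lookup p m))"
  by (rule poly_mapping_eqI)
    (auto simp: lookup_sum lookup_single when_def in_keys_iff)

lemma lookup_single_mult:
  fixes p :: "('v \<Rightarrow>\<^sub>0 nat) \<Rightarrow>\<^sub>0 'k::comm_semiring_1"
  shows "Poly_Mapping.lookup (Poly_Mapping.single k c * p) (k + m) = c * Poly_Mapping.lookup p m"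
proof -
  have "Poly_Mapping.single k c * p =
      (\<Sum>n \<in> Poly_Mapping.keys p. Poly_Mapping.single (k + n) (c * Poly_Mapping.lookup p n))"
    by (subst poly_mapping_sum_single[of p]) (simp add: sum_distrib_left mult_single)
  then show ?thesis by (auto simp: lookup_sum lookup_single when_def in_keys_iff)
qed

lemma keys_single_mult:
  fixes p :: "('v \<Rightarrow>\<^sub>0 nat) \<Rightarrow>\<^sub>0 'k::comm_semiring_1"
  shows "Poly_Mapping.keys (Poly_Mapping.single k 1 * p) = (+) k ` Poly_Mapping.keys p"
proof
  show "Poly_Mapping.keys (Poly_Mapping.single k 1 * p) \<subseteq> (+) k ` Poly_Mapping.keys p"
    using keys_mult[of "Poly_Mapping.single k 1" p] by auto
  show "(+) k ` Poly_Mapping.keys p \<subseteq> Poly_Mapping.keys (Poly_Mapping.single k 1 * p)"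
    by (auto simp: in_keys_iff lookup_single_mult)
qed

text \<open>An ideal when \<open>S\<close> is closed under enlarging. General \<open>S\<close> also
  covers the whole ring and, for vectors avoiding \<open>F\<close>, the polynomials in the remaining
  variables.\<close>

definition monomial_ideal ::
    "'v set \<Rightarrow> ('v multiset \<Rightarrow> bool) \<Rightarrow> (('v \<Rightarrow>\<^sub>0 nat) \<Rightarrow>\<^sub>0 'k::field) set" where
  "monomial_ideal V S =
     {p. \<forall>m \<in> Poly_Mapping.keys p. Poly_Mapping.keys m \<subseteq> V \<and> S (mset_of m)}"

lemma carrier_poly_ring: "carrier (poly_ring V) = monomial_ideal V (\<lambda>_. True)"
  by (simp add: poly_ring_def monomial_ideal_def)

lemma poly_ring_simps [simp]:
  "add (poly_ring V) = (+)" "mult (poly_ring V) = (*)" "one (poly_ring V) = 1" "zero (poly_ring V) = 0"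
  by (simp_all add: poly_ring_def)

lemma monomial_ideal_add:
  "p \<in> monomial_ideal V S \<Longrightarrow> q \<in> monomial_ideal V S \<Longrightarrow> p + q \<in> monomial_ideal V S"
  using Poly_Mapping.keys_add[of p q] by (fastforce simp: monomial_ideal_def)

lemma monomial_ideal_mult:
  assumes "p \<in> monomial_ideal V S" "q \<in> monomial_ideal V S'"
    and "\<And>a b. S a \<Longrightarrow> S' b \<Longrightarrow> S'' (a + b)"
  shows "p * q \<in> monomial_ideal V S''"
  unfolding monomial_ideal_def
proof (intro CollectI ballI)
  fix m assume "m \<in> Poly_Mapping.keys (p * q)"
  then obtain a b where m: "m = a + b" "a \<in> Poly_Mapping.keys p" "b \<in> Poly_Mapping.keys q"
    using keys_mult[of p q] by blast
  then have "Poly_Mapping.keys a \<union> Poly_Mapping.keys b \<subseteq> V" "S'' (mset_of m)"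
    using assms by (auto simp: monomial_ideal_def)
  then show "Poly_Mapping.keys m \<subseteq> V \<and> S'' (mset_of m)"
    using m(1) Poly_Mapping.keys_add[of a b] by auto
qed

lemma single_in_monomial_ideal:
  "Poly_Mapping.keys m \<subseteq> V \<Longrightarrow> S (mset_of m) \<Longrightarrow> Poly_Mapping.single m c \<in> monomial_ideal V S"
  by (simp add: monomial_ideal_def)

lemma monomial_ideal_minimal:
  assumes add: "\<And>p q. p \<in> K \<Longrightarrow> q \<in> K \<Longrightarrow> p + q \<in> K" and zero: "0 \<in> K"
    and single: "\<And>m c. Poly_Mapping.keys m \<subseteq> V \<Longrightarrow> S (mset_of m) \<Longrightarrow> Poly_Mapping.single m c \<in> K"
  shows "monomial_ideal V S \<subseteq> K"
proof
  fix p :: "('a \<Rightarrow>\<^sub>0 nat) \<Rightarrow>\<^sub>0 'b" assume p: "p \<in> monomial_ideal V S"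
  have "(\<Sum>m \<in> A. Poly_Mapping.single m (Poly_Mapping.lookup p m)) \<in> K"
    if "finite A" "A \<subseteq> Poly_Mapping.keys p" for A
    using that
    by (induction rule: finite_induct)
      (use p in \<open>auto simp: monomial_ideal_def intro!: add zero single\<close>)
  then show "p \<in> K" by (subst poly_mapping_sum_single) auto
qed

lemma ideal_monomial_ideal:
  assumes up: "\<And>a b. S a \<Longrightarrow> S (a + b)"
  shows "ideal (monomial_ideal V S) (poly_ring V)"
proof (rule idealI)
  interpret R: cring "poly_ring V :: (('a \<Rightarrow>\<^sub>0 nat) \<Rightarrow>\<^sub>0 'b) ring" by (rule cring_poly_ring)
  show "ring (poly_ring V :: (('a \<Rightarrow>\<^sub>0 nat) \<Rightarrow>\<^sub>0 'b) ring)" by (rule R.ring_axioms)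
  have uminus: "- p \<in> monomial_ideal V S" if "p \<in> monomial_ideal V S"
    for p :: "('a \<Rightarrow>\<^sub>0 nat) \<Rightarrow>\<^sub>0 'b"
    using that by (simp add: monomial_ideal_def)
  show "subgroup (monomial_ideal V S) (add_monoid (poly_ring V :: (('a \<Rightarrow>\<^sub>0 nat) \<Rightarrow>\<^sub>0 'b) ring))"
  proof (rule R.add.subgroupI)
    show "monomial_ideal V S \<subseteq> carrier (poly_ring V :: (('a \<Rightarrow>\<^sub>0 nat) \<Rightarrow>\<^sub>0 'b) ring)"
      by (auto simp: carrier_poly_ring monomial_ideal_def)
    show "monomial_ideal V S \<noteq> ({} :: (('a \<Rightarrow>\<^sub>0 nat) \<Rightarrow>\<^sub>0 'b) set)"
      by (auto simp: monomial_ideal_def intro!: exI[of _ 0])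
    fix p :: "('a \<Rightarrow>\<^sub>0 nat) \<Rightarrow>\<^sub>0 'b" assume p: "p \<in> monomial_ideal V S"
    then have "p \<in> carrier (poly_ring V)" "- p \<in> carrier (poly_ring V)"
      using uminus by (auto simp: carrier_poly_ring monomial_ideal_def)
    then have "\<ominus>\<^bsub>poly_ring V\<^esub> p = - p" using R.minus_equality[of "- p" p] by simp
    then show "\<ominus>\<^bsub>poly_ring V\<^esub> p \<in> monomial_ideal V S" using uminus p by simp
  qed (simp add: monomial_ideal_add)
next
  fix a x :: "('a \<Rightarrow>\<^sub>0 nat) \<Rightarrow>\<^sub>0 'b"
  assume a: "a \<in> monomial_ideal V S" "x \<in> carrier (poly_ring V)"
  have "x * a \<in> monomial_ideal V S"
    by (rule monomial_ideal_mult[OF a(2)[unfolded carrier_poly_ring] a(1)])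
      (metis up add.commute)
  then show "x \<otimes>\<^bsub>poly_ring V\<^esub> a \<in> monomial_ideal V S" "a \<otimes>\<^bsub>poly_ring V\<^esub> x \<in> monomial_ideal V S"
    by (simp_all add: mult.commute)
qed

definition meets :: "'v set \<Rightarrow> 'v multiset \<Rightarrow> bool" where
  "meets F a \<longleftrightarrow> set_mset a \<inter> F \<noteq> {}"

lemma ideal_meets: "ideal (monomial_ideal V (meets F)) (poly_ring V)"
  by (rule ideal_monomial_ideal) (auto simp: meets_def)

lemma genideal_vars:
  fixes V F :: "'v set"
  assumes "F \<subseteq> V"
  shows "Idl\<^bsub>poly_ring V\<^esub> (var ` F) =
    (monomial_ideal V (meets F) :: (('v \<Rightarrow>\<^sub>0 nat) \<Rightarrow>\<^sub>0 'k::field) set)"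
proof
  let ?R = "poly_ring V :: (('v \<Rightarrow>\<^sub>0 nat) \<Rightarrow>\<^sub>0 'k) ring"
  interpret R: cring ?R by (rule cring_poly_ring)
  have sub: "var ` F \<subseteq> carrier ?R" using assms by (auto simp: var_in_poly_ring)
  interpret I: ideal "Idl\<^bsub>?R\<^esub> (var ` F)" ?R by (rule R.genideal_ideal[OF sub])
  show "Idl\<^bsub>?R\<^esub> (var ` F) \<subseteq> monomial_ideal V (meets F)"
  proof (rule R.genideal_minimal[OF ideal_meets])
    show "var ` F \<subseteq> monomial_ideal V (meets F)"
      using assms by (auto simp: var_def meets_def intro!: single_in_monomial_ideal)
  qed
  show "monomial_ideal V (meets F) \<subseteq> Idl\<^bsub>?R\<^esub> (var ` F)"
  proof (rule monomial_ideal_minimal)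
    fix m :: "'v \<Rightarrow>\<^sub>0 nat" and c :: 'k
    assume m: "Poly_Mapping.keys m \<subseteq> V" "meets F (mset_of m)"
    then obtain i where i: "i \<in># mset_of m" "i \<in> F" unfolding meets_def by blast
    define m' where "m' = expo (mset_of m - {#i#})"
    have m': "m = m' + Poly_Mapping.single i 1"
      using i by (intro mset_of_inject) (simp add: m'_def del: set_mset_of)
    have "Poly_Mapping.keys m' \<subseteq> V"
      using m(1) unfolding set_mset_of[symmetric] m'_def mset_of_expo by (meson in_diffD subset_iff)
    then have "Poly_Mapping.single m' c \<in> carrier ?R"
      unfolding carrier_poly_ring by (intro single_in_monomial_ideal) auto
    moreover have "var i \<in> Idl\<^bsub>?R\<^esub> (var ` F)" using R.genideal_self[OF sub] i by auto
    ultimately have "Poly_Mapping.single m' c * var i \<in> Idl\<^bsub>?R\<^esub> (var ` F)"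
      using I.I_l_closed by fastforce
    then show "Poly_Mapping.single m c \<in> Idl\<^bsub>?R\<^esub> (var ` F)"
      by (simp add: m' var_def mult_single)
  qed (use I.a_closed I.zero_closed in auto)
qed

text \<open>The linear order on the variables provides the monomial order behind the absence of
  zero divisors.\<close>

lemma primeideal_meets:
  fixes V F :: "'v::linorder set"
  shows "primeideal (monomial_ideal V (meets F)) (poly_ring V :: (('v \<Rightarrow>\<^sub>0 nat) \<Rightarrow>\<^sub>0 'k::field) ring)"
proof (rule primeidealI[OF ideal_meets cring_poly_ring])
  let ?R = "poly_ring V :: (('v \<Rightarrow>\<^sub>0 nat) \<Rightarrow>\<^sub>0 'k) ring"
  let ?P = "monomial_ideal V (meets F) :: (('v \<Rightarrow>\<^sub>0 nat) \<Rightarrow>\<^sub>0 'k) set"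
  let ?C = "monomial_ideal V (\<lambda>a. \<not> meets F a) :: (('v \<Rightarrow>\<^sub>0 nat) \<Rightarrow>\<^sub>0 'k) set"
  interpret P: ideal ?P ?R by (rule ideal_meets)
  have PC: "p = 0" if "p \<in> ?P" "p \<in> ?C" for p
    using that by (auto simp: monomial_ideal_def simp flip: keys_eq_empty)
  have CC: "p * q \<in> ?C" if "p \<in> ?C" "q \<in> ?C" for p q
    by (rule monomial_ideal_mult[OF that]) (auto simp: meets_def)
  have one: "1 \<in> carrier ?R" "1 \<in> ?C"
    by (auto simp: carrier_poly_ring monomial_ideal_def meets_def)
  then show "carrier ?R \<noteq> ?P" using PC by fastforce
  \<comment> \<open>Modulo \<open>?P\<close> only the terms free of variables in \<open>F\<close>
    matter. They form the set \<open>?C\<close>, closed under products and meeting \<open>?P\<close>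
    only in 0, so primality reduces to the absence of zero divisors.\<close>
  have split: "\<exists>p' r. p = p' + r \<and> p' \<in> ?C \<and> r \<in> ?P" if p: "p \<in> carrier ?R" for p
  proof -
    have fin: "finite {m. (if meets F (mset_of m) then 0 else Poly_Mapping.lookup p m) \<noteq> 0}"
      by (rule finite_subset[OF _ finite_keys[of p]]) (auto simp: in_keys_iff split: if_splits)
    define p' where "p' = Abs_poly_mapping (\<lambda>m. if meets F (mset_of m) then 0 else Poly_Mapping.lookup p m)"
    have look: "Poly_Mapping.lookup p' m = (if meets F (mset_of m) then 0 else Poly_Mapping.lookup p m)" for m
      unfolding p'_def using fin by (subst lookup_Abs_poly_mapping) auto
    have "p' \<in> ?C" using p by (auto simp: monomial_ideal_def carrier_poly_ring in_keys_iff look split: if_splits)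
    moreover have "p - p' \<in> ?P"
      using p by (auto simp: monomial_ideal_def carrier_poly_ring in_keys_iff look lookup_minus split: if_splits)
    ultimately show ?thesis by (intro exI[of _ p'] exI[of _ "p - p'"]) auto
  qed
  fix a b assume ab: "a \<in> carrier ?R" "b \<in> carrier ?R" and "a \<otimes>\<^bsub>?R\<^esub> b \<in> ?P"
  then have abP: "a * b \<in> ?P" by simp
  obtain a' r where a': "a = a' + r" "a' \<in> ?C" "r \<in> ?P" using split[OF ab(1)] by auto
  obtain b' s where b': "b = b' + s" "b' \<in> ?C" "s \<in> ?P" using split[OF ab(2)] by auto
  have carr: "a' \<in> carrier ?R" using a'(2) by (auto simp: carrier_poly_ring monomial_ideal_def)
  have "a' * s \<in> ?P" "r * b \<in> ?P"
    using P.I_l_closed[OF b'(3) carr] P.I_r_closed[OF a'(3) ab(2)] by simp_all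
  then have rest: "a' * s + r * b \<in> ?P" by (rule monomial_ideal_add)
  then have "- (a' * s + r * b) \<in> ?P" by (simp only: monomial_ideal_def keys_minus mem_Collect_eq)
  then have "a * b + - (a' * s + r * b) \<in> ?P" using abP by (intro monomial_ideal_add)
  also have "a * b + - (a' * s + r * b) = a' * b'" by (simp add: a' b' algebra_simps)
  finally have "a' * b' = 0" using PC CC a' b' by blast
  then have "a' = 0 \<or> b' = 0" by simp
  then show "a \<in> ?P \<or> b \<in> ?P" using a' b' by auto
qed

context sym_irrefl
begin

lemma ideal_matchable: "ideal (monomial_ideal V (matchable t)) (poly_ring V)"
  by (rule ideal_monomial_ideal) (auto intro: matchable_mono)

text \<open>Induction on \<open>t\<close>: products add the numbers of edges, and a monomial
  divisible by \<open>Suc t\<close> edges is one edge times a monomial divisible by the other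
  \<open>t\<close>. The power is taken in the monoid of ideals, with the whole ring as its
  unit.\<close>

lemma edge_ideal_power:
  fixes G :: "('v, 'e) pre_digraph"
  assumes G: "arcs_ends G = E" and E: "E \<subseteq> V \<times> V"
  shows "edge_ideal (poly_ring V) G [^]\<^bsub>ideals_set (poly_ring V)\<^esub> t =
    (monomial_ideal V (matchable t) :: (('v \<Rightarrow>\<^sub>0 nat) \<Rightarrow>\<^sub>0 'k::field) set)"
proof (induction t)
  let ?R = "poly_ring V :: (('v \<Rightarrow>\<^sub>0 nat) \<Rightarrow>\<^sub>0 'k) ring"
  interpret R: cring ?R by (rule cring_poly_ring)
  {
    case 0
    have "(edge_ideal ?R G) [^]\<^bsub>ideals_set ?R\<^esub> (0::nat) = \<one>\<^bsub>ideals_set ?R\<^esub>"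
      by (rule Group.nat_pow_0)
    then show ?case by (simp add: ideals_set_def carrier_poly_ring)
  next
    case (Suc t)
    define gens where "gens = {var i * var j :: ('v \<Rightarrow>\<^sub>0 nat) \<Rightarrow>\<^sub>0 'k | i j. (i, j) \<in> arcs_ends G}"
    have I: "edge_ideal ?R G = Idl\<^bsub>?R\<^esub> gens" by (simp add: edge_ideal_def gens_def)
    have gens1: "gens \<subseteq> monomial_ideal V (matchable 1)"
    proof
      fix p assume "p \<in> gens"
      then obtain i j where ij: "(i, j) \<in> E" "p = var i * var j" by (auto simp: gens_def G)
      then have p: "p = Poly_Mapping.single (Poly_Mapping.single i 1 + Poly_Mapping.single j 1) 1"
        by (simp add: var_def mult_single)
      have "Poly_Mapping.keys (Poly_Mapping.single i (1::nat) + Poly_Mapping.single j 1) \<subseteq> V"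
        using Poly_Mapping.keys_add[of "Poly_Mapping.single i (1::nat)" "Poly_Mapping.single j 1"] ij E by auto
      then show "p \<in> monomial_ideal V (matchable 1)"
        unfolding p using matchable_edge[OF ij(1)] by (intro single_in_monomial_ideal) (auto simp: add_mset_commute)
    qed
    then have gens: "gens \<subseteq> carrier ?R" by (auto simp: carrier_poly_ring monomial_ideal_def)
    have I1: "edge_ideal ?R G \<subseteq> monomial_ideal V (matchable 1)"
      unfolding I by (rule R.genideal_minimal[OF ideal_matchable gens1])
    have "edge_ideal ?R G [^]\<^bsub>ideals_set ?R\<^esub> Suc t =
        ideal_prod ?R (monomial_ideal V (matchable t)) (edge_ideal ?R G)"
      by (simp add: Suc) (simp add: ideals_set_def)
    also have "\<dots> = monomial_ideal V (matchable (Suc t))"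
    proof
      show "ideal_prod ?R (monomial_ideal V (matchable t)) (edge_ideal ?R G)
          \<subseteq> monomial_ideal V (matchable (Suc t))"
      proof
        fix p assume "p \<in> ideal_prod ?R (monomial_ideal V (matchable t)) (edge_ideal ?R G)"
        then show "p \<in> monomial_ideal V (matchable (Suc t))"
        proof (induction rule: ideal_prod.induct)
          case (prod p q)
          then have "q \<in> monomial_ideal V (matchable 1)" using I1 by auto
          from monomial_ideal_mult[OF prod(1) this, of "matchable (Suc t)"] show ?case
            using matchable_add[of t _ 1] by simp
        qed (simp add: monomial_ideal_add)
      qed
      show "monomial_ideal V (matchable (Suc t))
          \<subseteq> ideal_prod ?R (monomial_ideal V (matchable t)) (edge_ideal ?R G)"
      proof (rule monomial_ideal_minimal)
        fix m :: "'v \<Rightarrow>\<^sub>0 nat" and c :: 'k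
        assume m: "Poly_Mapping.keys m \<subseteq> V" "matchable (Suc t) (mset_of m)"
        then obtain M where M: "edges M" "size M = Suc t" "deg M \<subseteq># mset_of m"
          by (auto simp: matchable_def)
        then obtain e N where eN: "M = add_mset e N" by (metis size_Suc_Diff1 size_eq_Suc_imp_eq_union)
        then obtain i j where ij: "(i, j) \<in> E" "e = {i, j}" using M by auto
        define m' where "m' = expo (mset_of m - {#i, j#})"
        have sub: "{#i, j#} + deg N \<subseteq># mset_of m" using M(3) eN ij by (simp add: mset_set_edge)
        then have "{#i, j#} \<subseteq># mset_of m" by (meson mset_subset_eq_add_left subset_mset.order_trans)
        then have m': "m = m' + (Poly_Mapping.single i 1 + Poly_Mapping.single j 1)"
          using subset_mset.diff_add by (intro mset_of_inject) (fastforce simp: m'_def add_mset_commute)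
        have "deg N \<subseteq># mset_of m'" using sub unfolding m' by (simp add: add.commute)
        then have "matchable t (mset_of m')" using M eN by (auto simp: matchable_def)
        moreover have "Poly_Mapping.keys m' \<subseteq> V"
          using m(1) unfolding set_mset_of[symmetric] m'_def mset_of_expo by (meson in_diffD subset_iff)
        ultimately have "Poly_Mapping.single m' c \<in> monomial_ideal V (matchable t)"
          by (intro single_in_monomial_ideal)
        moreover have "var i * var j \<in> edge_ideal ?R G"
          unfolding I using R.genideal_self[OF gens] ij by (auto simp: gens_def G)
        ultimately have "Poly_Mapping.single m' c \<otimes>\<^bsub>?R\<^esub> (var i * var j)
            \<in> ideal_prod ?R (monomial_ideal V (matchable t)) (edge_ideal ?R G)"
          by (rule ideal_prod.prod)
        then show "Poly_Mapping.single m c \<in> ideal_prod ?R (monomial_ideal V (matchable t)) (edge_ideal ?R G)"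
          by (simp add: m' var_def mult_single)
      next
        have "(0 :: ('v \<Rightarrow>\<^sub>0 nat) \<Rightarrow>\<^sub>0 'k) \<in> monomial_ideal V (matchable t)"
          by (simp add: monomial_ideal_def)
        moreover have "0 \<in> edge_ideal ?R G"
          unfolding I using additive_subgroup.zero_closed[OF ideal.axioms(1)[OF R.genideal_ideal[OF gens]]] by simp
        ultimately show "0 \<in> ideal_prod ?R (monomial_ideal V (matchable t)) (edge_ideal ?R G)"
          using ideal_prod.prod[of 0 _ 0 _ ?R] by fastforce
      qed (use ideal_prod.sum[of _ ?R] in auto)
    qed
    finally show ?case .
  }
qed

end

text \<open>The annihilator of the class of \<open>f\<close> is the colon ideal J : f.\<close>

lemma annihilator_quotient_module:
  assumes "cring R" "ideal J R" "f \<in> carrier R"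
  shows "annihilator R (quotient_module R J) (J +>\<^bsub>R\<^esub> f) = {r \<in> carrier R. r \<otimes>\<^bsub>R\<^esub> f \<in> J}"
proof -
  interpret R: cring R by fact
  interpret J: ideal J R by fact
  have "J +>\<^bsub>R\<^esub> x = J \<longleftrightarrow> x \<in> J" if "x \<in> carrier R" for x
    using that J.a_rcos_const J.rcos_const_imp_mem by (metis J.a_rcos_self)
  then show ?thesis
    using assms(3) unfolding annihilator_def
    by (intro Collect_cong conj_cong refl) (simp add: quotient_module_def FactRing_def J.rcoset_mult_add)
qed

context covered_graph
begin

text \<open>Some monomial of an \<open>f\<close> with annihilator \<open>P\<^sub>F\<close> is
  already a witness, and conversely a witness gives a monomial \<open>f\<close>. Primality is an
  assumption because \<open>primeideal_meets\<close> needs linearly ordered variables.\<close>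

lemma associated_prime_iff_witness:
  fixes G :: "('v, 'e) pre_digraph" and R :: "(('v \<Rightarrow>\<^sub>0 nat) \<Rightarrow>\<^sub>0 'k::field) ring"
  assumes prime: "primeideal (monomial_ideal V (meets F)) R"
    and R: "R = poly_ring V" and G: "arcs_ends G = E"
  shows "Idl\<^bsub>R\<^esub> (var ` F) \<in> associated_primes R (quotient_module R (edge_ideal R G [^]\<^bsub>ideals_set R\<^esub> t))
    \<longleftrightarrow> (\<exists>a. witness t a)"
proof -
  let ?J = "monomial_ideal V (matchable t) :: (('v \<Rightarrow>\<^sub>0 nat) \<Rightarrow>\<^sub>0 'k) set"
  let ?P = "monomial_ideal V (meets F) :: (('v \<Rightarrow>\<^sub>0 nat) \<Rightarrow>\<^sub>0 'k) set"
  have carr: "carrier R = monomial_ideal V (\<lambda>_. True)" by (simp add: R carrier_poly_ring)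
  have ideal: "ideal ?J R" unfolding R by (rule ideal_matchable)
  have cosets: "carrier (quotient_module R ?J) = {?J +>\<^bsub>R\<^esub> f | f. f \<in> carrier R}"
    by (auto simp: quotient_module_def FactRing_def A_RCOSETS_def')
  have "Idl\<^bsub>R\<^esub> (var ` F) \<in> associated_primes R (quotient_module R (edge_ideal R G [^]\<^bsub>ideals_set R\<^esub> t))
      \<longleftrightarrow> (\<exists>f \<in> carrier R. ?P = {r \<in> carrier R. r * f \<in> ?J})"
    unfolding associated_primes_def R genideal_vars[OF F_sub] edge_ideal_power[OF G E_sub]
    using prime cosets annihilator_quotient_module[OF cring_poly_ring ideal[unfolded R]]
    unfolding R by auto
  also have "\<dots> \<longleftrightarrow> (\<exists>a. witness t a)"
  proof safe
    fix f assume f: "f \<in> carrier R" and P: "?P = {r \<in> carrier R. r * f \<in> ?J}"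
    \<comment> \<open>If every monomial of \<open>f\<close> could be pushed into the power by
      variables outside \<open>F\<close>, the product of all these multipliers would annihilate
      \<open>f\<close> modulo the power without lying in \<open>P\<^sub>F\<close>.\<close>
    have "\<exists>m \<in> Poly_Mapping.keys f. \<forall>b. set_mset b \<subseteq> V - F \<longrightarrow> \<not> matchable t (mset_of m + b)"
    proof (rule ccontr)
      assume "\<not> ?thesis"
      then obtain b where b: "\<And>m. m \<in> Poly_Mapping.keys f \<Longrightarrow> set_mset (b m) \<subseteq> V - F"
        "\<And>m. m \<in> Poly_Mapping.keys f \<Longrightarrow> matchable t (mset_of m + b m)" by metis
      define B where "B = (\<Sum>m \<in> Poly_Mapping.keys f. b m)"
      let ?x = "Poly_Mapping.single (expo B) 1 :: ('v \<Rightarrow>\<^sub>0 nat) \<Rightarrow>\<^sub>0 'k"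
      have B: "set_mset B \<subseteq> V - F" unfolding B_def using b(1) by (auto simp: set_mset_sum)
      have keysB: "Poly_Mapping.keys (expo B) = set_mset B" by (simp flip: set_mset_of)
      have "?x * f \<in> ?J"
        unfolding monomial_ideal_def mem_Collect_eq keys_single_mult
      proof
        fix k assume "k \<in> (+) (expo B) ` Poly_Mapping.keys f"
        then obtain m where m: "m \<in> Poly_Mapping.keys f" "k = expo B + m" by blast
        have "b m \<subseteq># B" unfolding B_def using m by (simp add: sum.remove[of _ m])
        then have "matchable t (mset_of m + B)"
          using b(2)[OF m(1)] matchable_mono by (metis subset_mset.add_left_mono)
        then have "matchable t (mset_of k)" by (simp add: m(2) add.commute)
        moreover have "Poly_Mapping.keys m \<subseteq> V" using m f by (auto simp: carr monomial_ideal_def)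
        then have "Poly_Mapping.keys k \<subseteq> V"
          using Poly_Mapping.keys_add[of "expo B" m] keysB B m(2) by blast
        ultimately show "Poly_Mapping.keys k \<subseteq> V \<and> matchable t (mset_of k)" by blast
      qed
      moreover have "?x \<in> carrier R"
        using B unfolding carr by (intro single_in_monomial_ideal) (auto simp: keysB)
      ultimately have "?x \<in> ?P" using P by blast
      then show False using B by (auto simp: monomial_ideal_def meets_def keysB)
    qed
    then obtain m where m: "m \<in> Poly_Mapping.keys f"
      "\<And>b. set_mset b \<subseteq> V - F \<Longrightarrow> \<not> matchable t (mset_of m + b)" by blast
    have "matchable t (add_mset i (mset_of m))" if i: "i \<in> F" for i
    proof -
      have "var i \<in> ?P"
        using i F_sub by (auto simp: var_def meets_def intro!: single_in_monomial_ideal)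
      then have "var i * f \<in> ?J" using P by blast
      \<comment> \<open>Multiplication by a variable translates the support without cancellation, so
        each monomial of \<open>f\<close> can be treated separately.\<close>
      then have "matchable t (mset_of (Poly_Mapping.single i 1 + m))"
        using m(1) by (auto simp: var_def monomial_ideal_def keys_single_mult)
      then show ?thesis by simp
    qed
    moreover have "set_mset (mset_of m) \<subseteq> V" using m(1) f by (auto simp: carr monomial_ideal_def)
    ultimately show "\<exists>a. witness t a" unfolding witness_def using m(2) by blast
  next
    fix a assume "witness t a"
    then have a: "set_mset a \<subseteq> V" "\<And>i. i \<in> F \<Longrightarrow> matchable t (add_mset i a)"
      "\<And>b. set_mset b \<subseteq> V - F \<Longrightarrow> \<not> matchable t (a + b)" by (auto simp: witness_def)
    let ?f = "Poly_Mapping.single (expo a) 1 :: ('v \<Rightarrow>\<^sub>0 nat) \<Rightarrow>\<^sub>0 'k"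
    have keysa: "Poly_Mapping.keys (expo a) = set_mset a" by (simp flip: set_mset_of)
    have f: "?f \<in> carrier R"
      using a unfolding carr by (intro single_in_monomial_ideal) (auto simp: keysa)
    have mult: "matchable t (a + mset_of m) \<longleftrightarrow> meets F (mset_of m)" if "Poly_Mapping.keys m \<subseteq> V" for m
    proof
      assume "meets F (mset_of m)"
      then obtain i where i: "i \<in># mset_of m" "i \<in> F" by (auto simp: meets_def)
      then have "add_mset i a \<subseteq># a + mset_of m" by (simp del: set_mset_of)
      then show "matchable t (a + mset_of m)" using a(2)[OF i(2)] matchable_mono by blast
    next
      assume "matchable t (a + mset_of m)"
      then show "meets F (mset_of m)" using a(3)[of "mset_of m"] that by (auto simp: meets_def)
    qed
    have "r \<in> ?P \<longleftrightarrow> r \<in> carrier R \<and> r * ?f \<in> ?J" for r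
    proof -
      have "Poly_Mapping.keys (r * ?f) = (+) (expo a) ` Poly_Mapping.keys r"
        using keys_single_mult[of "expo a" r] by (simp add: mult.commute)
      moreover have sub: "Poly_Mapping.keys (expo a + m) \<subseteq> V" if "Poly_Mapping.keys m \<subseteq> V" for m
        using Poly_Mapping.keys_add[of "expo a" m] keysa a(1) that by auto
      ultimately show ?thesis
        using mult by (auto simp: monomial_ideal_def carr) (meson sub subsetD)
    qed
    then show "\<exists>f \<in> carrier R. ?P = {r \<in> carrier R. r * f \<in> ?J}"
      using f by (intro bexI[of _ ?f]) auto
  qed
  finally show ?thesis .
qed

end


section \<open>Components and ear decompositions of induced subgraphs\<close>

context sym_irrefl
begin

text \<open>The list form of \<open>ear_built\<close>. The covering condition is left out so that
  nonempty prefixes of such a list qualify as well.\<close>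

definition ears :: "'v list list \<Rightarrow> bool" where
  "ears ws \<longleftrightarrow> ws \<noteq> [] \<and> (\<forall>w \<in> set ws. ear w) \<and>
     hd (hd ws) = last (hd ws) \<and> 4 \<le> length (hd ws) \<and> even (length (hd ws)) \<and>
     (\<forall>k. 0 < k \<and> k < length ws \<longrightarrow>
        set (ws ! k) \<inter> (\<Union>j<k. set (ws ! j)) = {hd (ws ! k), last (ws ! k)})"

lemma UN_nth_set: "(\<Union>j<length ws. set (ws ! j)) = (\<Union>w\<in>set ws. set w)"
  unfolding set_conv_nth[of ws] by auto

lemma ears_append:
  assumes "ws \<noteq> []"
  shows "ears (ws @ [w]) \<longleftrightarrow>
    ears ws \<and> ear w \<and> set w \<inter> (\<Union>w\<in>set ws. set w) = {hd w, last w}"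
proof -
  have "(\<Union>j<k. set ((ws @ [w]) ! j)) = (\<Union>j<k. set (ws ! j))" if "k \<le> length ws" for k
    using that by (auto simp: nth_append)
  then have "(\<forall>k. 0 < k \<and> k < length (ws @ [w]) \<longrightarrow>
        set ((ws @ [w]) ! k) \<inter> (\<Union>j<k. set ((ws @ [w]) ! j)) = {hd ((ws @ [w]) ! k), last ((ws @ [w]) ! k)})
    \<longleftrightarrow> (\<forall>k. 0 < k \<and> k < length ws \<longrightarrow>
        set (ws ! k) \<inter> (\<Union>j<k. set (ws ! j)) = {hd (ws ! k), last (ws ! k)}) \<and>
      set w \<inter> (\<Union>w\<in>set ws. set w) = {hd w, last w}"
    using assms by (auto simp: less_Suc_eq nth_append UN_nth_set all_conj_distrib imp_conjL conj_disj_distribL)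
  then show ?thesis using assms unfolding ears_def by (simp add: conj_ac)
qed

lemma ear_length: "ear w \<Longrightarrow> 2 \<le> length w"
  by (simp add: ear_def)

lemma num_even_walks_append:
  "num_even_walks (ws @ [w]) = num_even_walks ws + of_bool (even (length w - 1))"
  by (simp add: num_even_walks_def)

lemma ear_built_iff_ears:
  "ear_built B q \<longleftrightarrow> (\<exists>ws. ears ws \<and> (\<Union>w\<in>set ws. set w) = B \<and> num_even_walks ws = q)"
proof
  assume "ear_built B q"
  then show "\<exists>ws. ears ws \<and> (\<Union>w\<in>set ws. set w) = B \<and> num_even_walks ws = q"
  proof (induction rule: ear_built.induct)
    case (cycle w)
    then show ?case
      by (intro exI[of _ "[w]"]) (auto simp: ears_def num_even_walks_def)
  next
    case (ear B q w)
    then obtain ws where ws: "ears ws" "(\<Union>w\<in>set ws. set w) = B" "num_even_walks ws = q" by blast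
    then have "ws \<noteq> []" by (simp add: ears_def)
    moreover have "even (length w - 1) \<longleftrightarrow> odd (length w)" using ear_length[OF ear(2)] by presburger
    ultimately show ?case
      using ws ear by (intro exI[of _ "ws @ [w]"]) (auto simp: ears_append num_even_walks_append)
  qed
next
  assume "\<exists>ws. ears ws \<and> (\<Union>w\<in>set ws. set w) = B \<and> num_even_walks ws = q"
  then obtain ws where ws: "ears ws" "(\<Union>w\<in>set ws. set w) = B" "num_even_walks ws = q" by blast
  have "ws \<noteq> []" using ws by (simp add: ears_def)
  then show "ear_built B q"
    using ws
  proof (induction ws arbitrary: B q rule: rev_nonempty_induct)
    case (single w)
    then show ?case
      using cycle[of w] by (auto simp: ears_def num_even_walks_def)
  next
    case (snoc w ws)
    then have w: "ears ws" "ear w" "set w \<inter> (\<Union>w\<in>set ws. set w) = {hd w, last w}"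
      by (auto simp: ears_append)
    have "even (length w - 1) \<longleftrightarrow> odd (length w)" using ear_length[OF w(2)] by presburger
    moreover have "(\<Union>w\<in>set (ws @ [w]). set w) = (\<Union>w\<in>set ws. set w) \<union> set w" by auto
    ultimately show ?case
      using ear[OF snoc(2)[OF w(1) refl refl] w(2,3)] snoc(4,5) by (simp add: num_even_walks_append)
  qed
qed

lemma vwalk_induced:
  assumes "verts C = S" "arcs_ends C = E \<inter> S \<times> S"
  shows "vwalk w C \<longleftrightarrow> w \<noteq> [] \<and> walk w \<and> set w \<subseteq> S"
proof -
  have "set (vwalk_arcs w) \<subseteq> E \<inter> S \<times> S \<longleftrightarrow> walk w" if "set w \<subseteq> S" for w
    using that by (induction w rule: vwalk_arcs.induct) auto
  then show ?thesis using assms by (auto simp: vwalk_def)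
qed

lemma ear_walk_induced:
  assumes "verts C = S" "arcs_ends C = E \<inter> S \<times> S"
  shows "ear_walk C w \<longleftrightarrow> ear w \<and> set w \<subseteq> S"
  unfolding ear_walk_def ear_def vwalk_induced[OF assms] by auto

lemma odd_cycle_induced:
  assumes "verts C = S" "arcs_ends C = E \<inter> S \<times> S"
  shows "odd_cycle C w \<longleftrightarrow>
    ear w \<and> set w \<subseteq> S \<and> hd w = last w \<and> 4 \<le> length w \<and> even (length w)"
  unfolding odd_cycle_def ear_walk_induced[OF assms] closed_vwalk_def by auto

lemma gen_ear_decomposition_induced:
  assumes "verts C = S" "arcs_ends C = E \<inter> S \<times> S"
  shows "gen_ear_decomposition C ws \<and> odd_cycle C (hd ws) \<longleftrightarrow> ears ws \<and> (\<Union>w\<in>set ws. set w) = S"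
  unfolding gen_ear_decomposition_def odd_cycle_induced[OF assms] ear_walk_induced[OF assms]
    ears_def closed_vwalk_def assms(1)
  by auto

lemma odd_beginning_iff_ear_built:
  assumes "verts C = S" "arcs_ends C = E \<inter> S \<times> S"
  shows "(\<exists>ws. gen_ear_decomposition C ws \<and> odd_cycle C (hd ws) \<and> num_even_walks ws = q)
    \<longleftrightarrow> ear_built S q"
  using gen_ear_decomposition_induced[OF assms] ear_built_iff_ears by metis

text \<open>An odd cycle extends to a decomposition by \<open>ear_built_extend\<close>; conversely
  the first walk of a decomposition is an odd cycle.\<close>

lemma odd_cycle_iff_ear_built:
  assumes "verts C = S" "arcs_ends C = E \<inter> S \<times> S" "finite S" "connected_on S"
  shows "(\<exists>w. odd_cycle C w) \<longleftrightarrow> (\<exists>q. ear_built S q)"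
proof
  assume "\<exists>w. odd_cycle C w"
  then obtain w where "ear w" "set w \<subseteq> S" "hd w = last w" "4 \<le> length w" "even (length w)"
    unfolding odd_cycle_induced[OF assms(1,2)] by blast
  then show "\<exists>q. ear_built S q" using ear_built_extend[OF assms(4,3) cycle] by blast
next
  assume "\<exists>q. ear_built S q"
  then show "\<exists>w. odd_cycle C w" using odd_beginning_iff_ear_built[OF assms(1,2)] by metis
qed

text \<open>The sum is the size of a nonempty factor-critical multiset. This parity is what makes
  mu* an integer.\<close>

lemma ear_built_odd:
  assumes "ear_built S q"
  shows "odd (q + card S)"
proof -
  obtain d where "factor_critical d" "size d = q + card S" "2 \<le> size d"
    using ear_built_imp_factor_critical[OF assms] by blast
  then show ?thesis using factor_critical_odd[of d] by fastforce
qed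

end

section \<open>Connected components of an induced subgraph\<close>

locale induced_pair_graph = pair_graph \<Gamma> for \<Gamma> :: "'v pair_pre_digraph" +
  fixes U :: "'v set"
  assumes U: "U \<subseteq> pverts \<Gamma>"
begin

sublocale sym_irrefl "parcs \<Gamma>"
  by unfold_locales (auto dest: arcs_symmetric no_loops')

abbreviation H where "H \<equiv> with_proj \<Gamma> \<restriction> U"

sublocale H: sym_digraph H
  by (rule induced_graph_imp_graph) (use U in \<open>auto intro: induced_induce\<close>)

abbreviation \<C> where "\<C> \<equiv> H.sccs_verts"

lemma arcs_ends_H: "arcs_ends H = parcs \<Gamma> \<inter> U \<times> U"
  by (auto simp: arcs_ends_def arc_to_ends_def)

lemma arcs_ends_HS: "S \<subseteq> U \<Longrightarrow> arcs_ends (H \<restriction> S) = parcs \<Gamma> \<inter> S \<times> S"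
  by (auto simp: arcs_ends_def arc_to_ends_def)

lemma finite_U: "finite U"
  using U pair_finite_verts finite_subset by blast

lemma sccs_verts_subset: "S \<in> \<C> \<Longrightarrow> S \<subseteq> U"
  using H.reachable_in_verts by (fastforce simp: H.sccs_verts_def)

text \<open>Arcs come in opposite pairs, so a strong component contains all neighbours in
  \<open>U\<close> of its vertices. It is connected because a path leaving a part \<open>B\<close>
  has to cross an arc out of \<open>B\<close>.\<close>

lemma components_sccs_verts: "components U \<C>"
proof -
  have ne: "S \<noteq> {}" if "S \<in> \<C>" for S using that by (simp add: H.sccs_verts_def)
  have closed: "y \<in> S" if "S \<in> \<C>" "x \<in> S" "y \<in> U" "(x, y) \<in> parcs \<Gamma>" for S x y
  proof (rule ccontr)
    assume "y \<notin> S"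
    have "x \<rightarrow>\<^bsub>H\<^esub> y" "y \<rightarrow>\<^bsub>H\<^esub> x"
      using that sccs_verts_subset[of S] adj_sym by (auto simp: arcs_ends_H)
    then have "x \<rightarrow>\<^sup>*\<^bsub>H\<^esub> y" "y \<rightarrow>\<^sup>*\<^bsub>H\<^esub> x" by (auto intro: H.reachable_adjI)
    then show False using that \<open>y \<notin> S\<close> by (auto simp: H.sccs_verts_def)
  qed
  have conn: "connected_on S" if S: "S \<in> \<C>" for S
    unfolding connected_on_def
  proof (intro allI impI, elim conjE)
    fix B assume "B \<noteq> {}" "B \<subset> S"
    then obtain x where B: "x \<in> B" "B \<subset> S" by blast
    then obtain w where w: "w \<in> S" "w \<notin> B" by blast
    have "x \<rightarrow>\<^sup>*\<^bsub>H\<^esub> w" using S B w by (auto simp: H.sccs_verts_def)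
    then show "\<exists>u\<in>B. \<exists>w\<in>S - B. (u, w) \<in> parcs \<Gamma>"
    proof (rule contrapos_pp)
      assume none: "\<not> (\<exists>u\<in>B. \<exists>w\<in>S - B. (u, w) \<in> parcs \<Gamma>)"
      have "v \<in> B" if "x \<rightarrow>\<^sup>*\<^bsub>H\<^esub> v" for v
        using that
      proof (induction rule: H.reachable_induct)
        case (step y z)
        then have "(y, z) \<in> parcs \<Gamma>" "z \<in> U" by (auto simp: arcs_ends_H)
        moreover have "y \<in> S" using step B by blast
        ultimately have "z \<in> S" using closed[OF S] by blast
        then show ?case using none step \<open>(y, z) \<in> parcs \<Gamma>\<close> by blast
      qed (use B in auto)
      then show "\<not> x \<rightarrow>\<^sup>*\<^bsub>H\<^esub> w" using w by blast
    qed
  qed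
  have "\<Union>\<C> = U"
  proof
    show "\<Union>\<C> \<subseteq> U" using sccs_verts_subset by blast
    show "U \<subseteq> \<Union>\<C>"
    proof
      fix u assume u: "u \<in> U"
      then have "H \<restriction> {v. u \<rightarrow>\<^sup>*\<^bsub>H\<^esub> v} \<in> H.sccs" by (intro H.induce_reachable_is_in_sccs) simp
      then have "verts (H \<restriction> {v. u \<rightarrow>\<^sup>*\<^bsub>H\<^esub> v}) \<in> \<C>" unfolding H.sccs_verts_conv by (rule imageI)
      moreover have "u \<in> verts (H \<restriction> {v. u \<rightarrow>\<^sup>*\<^bsub>H\<^esub> v})" using u by simp
      ultimately show "u \<in> \<Union>\<C>" by blast
    qed
  qed
  then show ?thesis
    unfolding components_def
    using finite_U ne conn closed H.sccs_verts_disjoint by blast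
qed

lemma finite_sccs_verts: "finite \<C>"
  using finite_components[OF components_sccs_verts] .

lemma sccs_eq: "H.sccs = (\<lambda>S. H \<restriction> S) ` \<C>"
  by (rule H.sccs_conv_sccs_verts)

lemma inj_induce: "inj_on (\<lambda>S. H \<restriction> S) A"
  by (rule inj_onI) (metis induce_subgraph_verts)

lemma sccs_verts_props:
  assumes "S \<in> \<C>"
  shows "verts (H \<restriction> S) = S" "arcs_ends (H \<restriction> S) = parcs \<Gamma> \<inter> S \<times> S" "finite S" "connected_on S"
proof -
  show "verts (H \<restriction> S) = S" by simp
  show "arcs_ends (H \<restriction> S) = parcs \<Gamma> \<inter> S \<times> S" by (rule arcs_ends_HS[OF sccs_verts_subset[OF assms]])
  show "finite S" by (rule finite_subset[OF sccs_verts_subset[OF assms] finite_U])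
  show "connected_on S" using components_sccs_verts assms by (simp add: components_def)
qed

lemma strongly_nonbipartite_iff: "strongly_nonbipartite H \<longleftrightarrow> (\<forall>S \<in> \<C>. \<exists>q. ear_built S q)"
proof -
  have "(\<exists>w. odd_cycle (H \<restriction> S) w) \<longleftrightarrow> (\<exists>q. ear_built S q)" if "S \<in> \<C>" for S
    by (rule odd_cycle_iff_ear_built[OF sccs_verts_props[OF that]])
  then show ?thesis unfolding strongly_nonbipartite_def sccs_eq by simp
qed

text \<open>The walks no longer occur: only the possible numbers of even walks per component matter
  for the minimum.\<close>

lemma phi_star_eq:
  "phi_star H = (LEAST q. \<exists>f. (\<forall>S \<in> \<C>. ear_built S (f S)) \<and> q = (\<Sum>S \<in> \<C>. f S))"
proof -
  have "(\<exists>D. odd_beginning_gen_ear_decomposition H D \<and> q = (\<Sum>C \<in> H.sccs. num_even_walks (D C)))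
    \<longleftrightarrow> (\<exists>f. (\<forall>S \<in> \<C>. ear_built S (f S)) \<and> q = (\<Sum>S \<in> \<C>. f S))" for q
  proof
    assume "\<exists>D. odd_beginning_gen_ear_decomposition H D \<and> q = (\<Sum>C \<in> H.sccs. num_even_walks (D C))"
    then obtain D where D: "odd_beginning_gen_ear_decomposition H D"
      "q = (\<Sum>C \<in> H.sccs. num_even_walks (D C))" by blast
    have "\<forall>S \<in> \<C>. ear_built S (num_even_walks (D (H \<restriction> S)))"
      using D(1) odd_beginning_iff_ear_built[OF sccs_verts_props(1,2)]
      unfolding odd_beginning_gen_ear_decomposition_def sccs_eq by blast
    moreover have "q = (\<Sum>S \<in> \<C>. num_even_walks (D (H \<restriction> S)))"
      unfolding D(2) sccs_eq by (simp add: sum.reindex[OF inj_induce])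
    ultimately show "\<exists>f. (\<forall>S \<in> \<C>. ear_built S (f S)) \<and> q = (\<Sum>S \<in> \<C>. f S)"
      by (intro exI[of _ "\<lambda>S. num_even_walks (D (H \<restriction> S))"]) blast
  next
    assume "\<exists>f. (\<forall>S \<in> \<C>. ear_built S (f S)) \<and> q = (\<Sum>S \<in> \<C>. f S)"
    then obtain f where f: "\<forall>S \<in> \<C>. ear_built S (f S)" "q = (\<Sum>S \<in> \<C>. f S)" by blast
    have "\<forall>S \<in> \<C>. \<exists>ws. gen_ear_decomposition (H \<restriction> S) ws \<and> odd_cycle (H \<restriction> S) (hd ws) \<and>
        num_even_walks ws = f S"
      using f(1) odd_beginning_iff_ear_built[OF sccs_verts_props(1,2)] by blast
    then obtain ws where ws: "\<forall>S \<in> \<C>. gen_ear_decomposition (H \<restriction> S) (ws S) \<and>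
        odd_cycle (H \<restriction> S) (hd (ws S)) \<and> num_even_walks (ws S) = f S" by metis
    \<comment> \<open>Decompositions are indexed by component digraphs, which are recovered from
      their vertex sets.\<close>
    let ?D = "\<lambda>C. ws (verts C)"
    have "odd_beginning_gen_ear_decomposition H ?D"
      using ws unfolding odd_beginning_gen_ear_decomposition_def sccs_eq by simp
    moreover have "q = (\<Sum>C \<in> H.sccs. num_even_walks (?D C))"
      unfolding f(2) sccs_eq using ws by (simp add: sum.reindex[OF inj_induce])
    ultimately show "\<exists>D. odd_beginning_gen_ear_decomposition H D \<and>
        q = (\<Sum>C \<in> H.sccs. num_even_walks (D C))" by blast
  qed
  then show ?thesis unfolding phi_star_def by simp
qed

text \<open>As \<open>f S + card S\<close> is odd, the rounding in \<open>div 2\<close> subtracts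
  one half per component, which accounts for the term - c in mu*. So the sum is the value of mu*
  with \<open>phi_star\<close> replaced by the total of \<open>f\<close>, and a minimal
  \<open>f\<close> attains mu*.\<close>

lemma mu_star_less_iff:
  assumes "strongly_nonbipartite H"
  shows "mu_star H < of_nat t \<longleftrightarrow>
    (\<exists>f. (\<forall>S \<in> \<C>. ear_built S (f S)) \<and> (\<Sum>S \<in> \<C>. (f S + card S) div 2) < t)"
proof -
  let ?good = "\<lambda>f. \<forall>S \<in> \<C>. ear_built S (f S)"
  let ?Q = "\<lambda>q. \<exists>f. ?good f \<and> q = sum f \<C>"
  have cardU: "card U = (\<Sum>S \<in> \<C>. card S)"
    using components_sccs_verts card_Union_disjoint[of \<C>] finite_subset[OF _ finite_U]
    unfolding components_def pairwise_def disjnt_def by (metis Union_upper)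
  have "card (verts H) = card U" "card H.sccs = card \<C>"
    unfolding sccs_eq by (simp_all add: card_image[OF inj_induce])
  then have mu: "mu_star H = (of_nat (phi_star H) + of_nat (card U) - of_nat (card \<C>)) / 2"
    by (simp add: mu_star_def)
  have eq: "2 * (\<Sum>S \<in> \<C>. (f S + card S) div 2) + card \<C> = sum f \<C> + card U" if "?good f" for f
  proof -
    have "2 * ((f S + card S) div 2) + 1 = f S + card S" if "S \<in> \<C>" for S
      using ear_built_odd \<open>?good f\<close> that by (metis odd_two_times_div_two_succ)
    then have "(\<Sum>S \<in> \<C>. 2 * ((f S + card S) div 2) + 1) = (\<Sum>S \<in> \<C>. f S + card S)"
      by (intro sum.cong) auto
    then show ?thesis unfolding cardU sum.distrib by (simp flip: sum_distrib_left)
  qed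
  obtain g where "?good g" using assms unfolding strongly_nonbipartite_iff by metis
  then have "\<exists>q. ?Q q" by blast
  from LeastI_ex[OF this] have "?Q (phi_star H)" unfolding phi_star_eq .
  then obtain f0 where f0: "?good f0" "phi_star H = sum f0 \<C>" by blast
  have least: "sum f0 \<C> \<le> sum f \<C>" if "?good f" for f
    unfolding f0(2)[symmetric] phi_star_eq by (rule Least_le) (use that in blast)
  have "mu_star H = of_nat (\<Sum>S \<in> \<C>. (f0 S + card S) div 2)"
    using arg_cong[OF eq[OF f0(1)], of "of_nat :: nat \<Rightarrow> rat"] unfolding mu f0(2)
    by (simp only: of_nat_add of_nat_mult) simp
  then have "mu_star H < of_nat t \<longleftrightarrow> (\<Sum>S \<in> \<C>. (f0 S + card S) div 2) < t"
    by (simp only: of_nat_less_iff)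
  moreover have "(\<Sum>S \<in> \<C>. (f0 S + card S) div 2) \<le> (\<Sum>S \<in> \<C>. (f S + card S) div 2)"
    if "?good f" for f
    using eq[OF f0(1)] eq[OF that] least[OF that] by linarith
  ultimately show ?thesis using f0(1) by (meson le_less_trans)
qed

end

section \<open>Minimality of covers through neighbours outside the cover\<close>

context pair_graph
begin

lemma covered_graph:
  assumes "vertex_cover G F"
  shows "covered_graph (parcs G) (pverts G) F"
proof unfold_locales
  show "(x, y) \<in> parcs G \<Longrightarrow> (y, x) \<in> parcs G" for x y by (rule arcs_symmetric)
  show "(x, x) \<notin> parcs G" for x using no_loops' by blast
  show "finite (pverts G)" by (rule pair_finite_verts)
  show "parcs G \<subseteq> pverts G \<times> pverts G" using in_arcsD1 in_arcsD2 by auto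
  show "F \<subseteq> pverts G" "(x, y) \<in> parcs G \<Longrightarrow> x \<in> F \<or> y \<in> F" for x y
    using assms by (auto simp: vertex_cover_def)
qed

lemma minimal_vertex_cover_containing_iff:
  assumes "vertex_cover G F"
  shows "minimal_vertex_cover_containing G W F \<longleftrightarrow>
    W \<subseteq> F \<and> (\<forall>i \<in> F - W. \<exists>y \<in> pverts G - F. (i, y) \<in> parcs G)"
proof
  assume min: "minimal_vertex_cover_containing G W F"
  have "\<exists>y \<in> pverts G - F. (i, y) \<in> parcs G" if i: "i \<in> F - W" for i
  proof (rule ccontr)
    assume none: "\<not> ?thesis"
    have "y \<in> F \<and> y \<noteq> i" if "(i, y) \<in> parcs G \<or> (y, i) \<in> parcs G" for y
      using that none arcs_symmetric in_arcsD2 no_loops' by blast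
    moreover have "x \<in> F \<or> y \<in> F" if "(x, y) \<in> parcs G" for x y
      using assms that by (auto simp: vertex_cover_def)
    moreover have "F \<subseteq> pverts G" using assms by (simp add: vertex_cover_def)
    ultimately have "vertex_cover G (F - {i})" unfolding vertex_cover_def by fastforce
    then have "F - {i} = F"
      using min i unfolding minimal_vertex_cover_containing_def by blast
    then show False using i by blast
  qed
  then show "W \<subseteq> F \<and> (\<forall>i \<in> F - W. \<exists>y \<in> pverts G - F. (i, y) \<in> parcs G)"
    using min by (auto simp: minimal_vertex_cover_containing_def)
next
  assume *: "W \<subseteq> F \<and> (\<forall>i \<in> F - W. \<exists>y \<in> pverts G - F. (i, y) \<in> parcs G)"
  have "F' = F" if F': "vertex_cover G F'" "W \<subseteq> F'" "F' \<subseteq> F" for F'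
  proof (rule ccontr)
    assume "F' \<noteq> F"
    then obtain i where i: "i \<in> F" "i \<notin> F'" using F' by blast
    then obtain y where "y \<notin> F" "(i, y) \<in> parcs G" using * F' by blast
    then show False using F' i unfolding vertex_cover_def by auto
  qed
  then show "minimal_vertex_cover_containing G W F"
    using assms * unfolding minimal_vertex_cover_containing_def by blast
qed

lemma minimal_vertex_cover_iff:
  assumes "vertex_cover G F"
  shows "minimal_vertex_cover G F \<longleftrightarrow> (\<forall>i \<in> F. \<exists>y \<in> pverts G - F. (i, y) \<in> parcs G)"
  using minimal_vertex_cover_containing_iff[OF assms, of "{}"]
  by (simp add: minimal_vertex_cover_def minimal_vertex_cover_containing_def)

end

section \<open>The combinatorial form of the equivalence\<close>

theorem witness_iff:
  fixes \<Gamma> :: "'v pair_pre_digraph"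
  assumes "pair_graph \<Gamma>" "t \<ge> 1" and F: "vertex_cover \<Gamma> F"
  shows "(\<exists>a. covered_graph.witness (parcs \<Gamma>) (pverts \<Gamma>) F t a) \<longleftrightarrow>
    minimal_vertex_cover \<Gamma> F \<or>
    (\<exists>U \<subseteq> pverts \<Gamma>. strongly_nonbipartite (\<Gamma> \<restriction> U) \<and> mu_star (\<Gamma> \<restriction> U) < of_nat t \<and>
       minimal_vertex_cover_containing \<Gamma> (closed_neighborhood \<Gamma> U) F)"
proof -
  interpret G: pair_graph \<Gamma> by fact
  interpret covered_graph "parcs \<Gamma>" "pverts \<Gamma>" F using F by (rule G.covered_graph)
  have sub: "induced_pair_graph \<Gamma> U" if "U \<subseteq> pverts \<Gamma>" for U
    using that by unfold_locales
  show ?thesis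
  proof
    assume "\<exists>a. witness t a"
    then obtain a where "witness t a" ..
    from witness_imp_critical[OF this] obtain s c where s: "s < t" and cF: "set_mset c \<subseteq> F"
      and max: "\<not> matchable (Suc s) c"
      and crit: "\<And>i. i \<in># c \<Longrightarrow> matchable s (c - {#i#})"
      and nbr: "\<And>i y. i \<in># c \<Longrightarrow> (i, y) \<in> parcs \<Gamma> \<Longrightarrow> y \<in> F"
      and dom: "\<And>l. l \<in> F \<Longrightarrow> \<exists>y. (l, y) \<in> parcs \<Gamma> \<and> (y \<in># c \<or> y \<in> pverts \<Gamma> - F)"
      by (elim exE conjE) blast
    define U where "U = set_mset c"
    have UV: "U \<subseteq> pverts \<Gamma>" using cF F_sub U_def by blast
    interpret I: induced_pair_graph \<Gamma> U using UV by (rule sub)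
    \<comment> \<open>\<open>dom\<close> offers a neighbour in \<open>c\<close> or outside
      \<open>F\<close>; \<open>nbr\<close> excludes the latter.\<close>
    have "\<exists>j \<in> U. (i, j) \<in> parcs \<Gamma>" if "i \<in> U" for i
      using dom[of i] nbr[of i] that cF unfolding U_def by blast
    then obtain k where k: "\<forall>S \<in> I.\<C>. ear_built_le S (2 * k S + 1)" "sum k I.\<C> \<le> s"
      using critical_components[OF I.components_sccs_verts U_def[symmetric] max] crit
      unfolding U_def by blast
    then obtain f where f: "\<forall>S \<in> I.\<C>. ear_built S (f S) \<and> f S + card S \<le> 2 * k S + 1"
      unfolding ear_built_le_def by metis
    have nonbip: "strongly_nonbipartite (\<Gamma> \<restriction> U)"
      unfolding I.strongly_nonbipartite_iff using f by blast
    moreover have "(\<Sum>S \<in> I.\<C>. (f S + card S) div 2) \<le> sum k I.\<C>"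
      using f by (intro sum_mono) fastforce
    then have "mu_star (\<Gamma> \<restriction> U) < of_nat t"
      unfolding I.mu_star_less_iff[OF nonbip] using f k(2) s by (intro exI[of _ f]) auto
    moreover have "minimal_vertex_cover_containing \<Gamma> (closed_neighborhood \<Gamma> U) F"
      unfolding G.minimal_vertex_cover_containing_iff[OF F]
    proof safe
      fix x assume "x \<in> closed_neighborhood \<Gamma> U"
      then show "x \<in> F" using nbr cF by (auto simp: closed_neighborhood_def U_def)
    next
      fix i assume "i \<in> F" "i \<notin> closed_neighborhood \<Gamma> U"
      moreover from this obtain y where y: "(i, y) \<in> parcs \<Gamma>" "y \<in># c \<or> y \<in> pverts \<Gamma> - F"
        using dom by blast
      ultimately have "y \<in> pverts \<Gamma> - F"
        using adj_sym by (auto simp: closed_neighborhood_def U_def)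
      then show "\<exists>y \<in> pverts \<Gamma> - F. (i, y) \<in> parcs \<Gamma>" using y by blast
    qed
    ultimately show "minimal_vertex_cover \<Gamma> F \<or>
      (\<exists>U \<subseteq> pverts \<Gamma>. strongly_nonbipartite (\<Gamma> \<restriction> U) \<and> mu_star (\<Gamma> \<restriction> U) < of_nat t \<and>
         minimal_vertex_cover_containing \<Gamma> (closed_neighborhood \<Gamma> U) F)"
      using UV by blast
  next
    assume rhs: "minimal_vertex_cover \<Gamma> F \<or>
      (\<exists>U \<subseteq> pverts \<Gamma>. strongly_nonbipartite (\<Gamma> \<restriction> U) \<and> mu_star (\<Gamma> \<restriction> U) < of_nat t \<and>
         minimal_vertex_cover_containing \<Gamma> (closed_neighborhood \<Gamma> U) F)"
    have minimal: "\<exists>a. witness t a" if "minimal_vertex_cover \<Gamma> F"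
    proof (rule witness_minimal_cover[OF _ assms(2)])
      fix i assume "i \<in> F"
      then show "\<exists>y \<in> pverts \<Gamma> - F. (i, y) \<in> parcs \<Gamma>"
        using that unfolding G.minimal_vertex_cover_iff[OF F] by blast
    qed
    from rhs show "\<exists>a. witness t a"
    proof (elim disjE exE conjE)
      fix U assume UV: "U \<subseteq> pverts \<Gamma>" and nonbip: "strongly_nonbipartite (\<Gamma> \<restriction> U)"
        and mu: "mu_star (\<Gamma> \<restriction> U) < of_nat t"
        and min: "minimal_vertex_cover_containing \<Gamma> (closed_neighborhood \<Gamma> U) F"
      interpret I: induced_pair_graph \<Gamma> U using UV by (rule sub)
      have NF: "closed_neighborhood \<Gamma> U \<subseteq> F"
        and out: "\<And>i. i \<in> F \<Longrightarrow> i \<notin> closed_neighborhood \<Gamma> U \<Longrightarrow> \<exists>y \<in> pverts \<Gamma> - F. (i, y) \<in> parcs \<Gamma>"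
        using min unfolding G.minimal_vertex_cover_containing_iff[OF F] by auto
      \<comment> \<open>For empty \<open>U\<close> the closed neighborhood is empty, so
        \<open>F\<close> is a minimal cover, and there is no component in which to place additional
        edges.\<close>
      show ?thesis
      proof (cases "U = {}")
        case True
        then have "minimal_vertex_cover \<Gamma> F"
          unfolding G.minimal_vertex_cover_iff[OF F] using out by (auto simp: closed_neighborhood_def)
        then show ?thesis by (rule minimal)
      next
        case False
        moreover have "\<Union>I.\<C> = U" using I.components_sccs_verts by (simp add: components_def)
        ultimately obtain S0 where S0: "S0 \<in> I.\<C>" by blast
        obtain f where f: "\<forall>S \<in> I.\<C>. ear_built S (f S)" "(\<Sum>S \<in> I.\<C>. (f S + card S) div 2) < t"
          using mu unfolding I.mu_star_less_iff[OF nonbip] by blast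
        \<comment> \<open>The number of edges still missing for a total of \<open>t - 1\<close>. All
          of them are placed in the one component \<open>S0\<close>.\<close>
        define e where "e = t - 1 - (\<Sum>S \<in> I.\<C>. (f S + card S) div 2)"
        have "\<exists>d. factor_critical d \<and> set_mset d = S \<and> 2 \<le> size d \<and>
            size d = f S + card S + 2 * (if S = S0 then e else 0)" if SC: "S \<in> I.\<C>" for S
        proof -
          obtain d where d: "factor_critical d" "set_mset d = S" "size d = f S + card S" "2 \<le> size d"
            using ear_built_imp_factor_critical[of S "f S"] f(1) SC by blast
          obtain d' where "factor_critical d'" "set_mset d' = set_mset d"
            "size d' = size d + 2 * (if S = S0 then e else 0)"
            using factor_critical_enlarge[OF d(1,4)] by blast
          then show ?thesis using d by (intro exI[of _ d']) simp
        qed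
        then have "\<forall>S \<in> I.\<C>. \<exists>d. factor_critical d \<and> set_mset d = S \<and> 2 \<le> size d \<and>
            size d = f S + card S + 2 * (if S = S0 then e else 0)" by blast
        from bchoice[OF this] obtain d where d: "\<And>S. S \<in> I.\<C> \<Longrightarrow> factor_critical (d S) \<and> set_mset (d S) = S \<and> 2 \<le> size (d S)"
          "\<And>S. S \<in> I.\<C> \<Longrightarrow> size (d S) = f S + card S + 2 * (if S = S0 then e else 0)" by blast
        have "(\<Sum>S \<in> I.\<C>. size (d S) div 2) = (\<Sum>S \<in> I.\<C>. (f S + card S) div 2 + (if S = S0 then e else 0))"
          using d(2) by (intro sum.cong) auto
        also have "\<dots> = (\<Sum>S \<in> I.\<C>. (f S + card S) div 2) + e"
          using S0 I.finite_sccs_verts by (simp add: sum.distrib)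
        finally have t: "t = Suc (\<Sum>S \<in> I.\<C>. size (d S) div 2)" using f(2) by (simp add: e_def)
        have "witness t (sum d I.\<C> + mset_set (pverts \<Gamma> - F))"
        proof (rule witness_factor_critical[OF I.components_sccs_verts d(1) t])
          show "U \<subseteq> F" using NF by (auto simp: closed_neighborhood_def)
          show "y \<in> F" if "u \<in> U" "(u, y) \<in> parcs \<Gamma>" for u y
            using NF that by (auto simp: closed_neighborhood_def)
          show "\<exists>y \<in> U \<union> (pverts \<Gamma> - F). (i, y) \<in> parcs \<Gamma>" if "i \<in> F" "i \<notin> U" for i
          proof (cases "i \<in> closed_neighborhood \<Gamma> U")
            case True
            then show ?thesis using that adj_sym by (auto simp: closed_neighborhood_def)
          qed (use out that in blast)
        qed
        then show ?thesis by blast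
      qed
    qed (rule minimal)
  qed
qed

theorem theorem4p4:
  fixes n t :: nat
    and \<Gamma> :: "nat pair_pre_digraph"
    and R :: "((nat \<Rightarrow>\<^sub>0 nat) \<Rightarrow>\<^sub>0 'k::field) ring"
    and F :: "nat set"
  assumes "pair_graph \<Gamma>" and "pverts \<Gamma> = {1..n}"
    and "R = poly_ring {1..n}"
    and "t \<ge> 1"
    and "vertex_cover \<Gamma> F"
  shows "Idl\<^bsub>R\<^esub> (var ` F)
           \<in> associated_primes R (quotient_module R (edge_ideal R \<Gamma> [^]\<^bsub>ideals_set R\<^esub> t))
    \<longleftrightarrow> minimal_vertex_cover \<Gamma> F \<or>
        (\<exists>U \<subseteq> {1..n}. strongly_nonbipartite (\<Gamma> \<restriction> U) \<and> mu_star (\<Gamma> \<restriction> U) < of_nat t \<and>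
           minimal_vertex_cover_containing \<Gamma> (closed_neighborhood \<Gamma> U) F)"
proof -
  interpret G: pair_graph \<Gamma> by fact
  interpret covered_graph "parcs \<Gamma>" "{1..n}" F
    using G.covered_graph[OF assms(5)] unfolding assms(2) .
  have "primeideal (monomial_ideal {1..n} (meets F)) R"
    unfolding assms(3) by (rule primeideal_meets)
  then have "Idl\<^bsub>R\<^esub> (var ` F) \<in>
      associated_primes R (quotient_module R (edge_ideal R \<Gamma> [^]\<^bsub>ideals_set R\<^esub> t))
    \<longleftrightarrow> (\<exists>a. witness t a)"
    by (rule associated_prime_iff_witness) (simp_all add: assms(3))
  then show ?thesis using witness_iff[OF assms(1,4,5)] assms(2) by simp
qed

end
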